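(* For every integer $n\ge 3$, let $M(n)$ be the smallest integer $N$ such that every family of $N$ noncrossing convex bodies in general position in the plane has $n$ members in convex position. Then $$M(n)\le N_3(3,n)\le 2^{n^2\log_2 n}.$$
   Context: A convex body is a compact convex set in the plane with nonempty interior. A family $\mathcal C$ of convex bodies is in convex position if no member is contained in the convex hull of the union of the others. $\mathcal C$ is in general position if (1) every three members are in convex position, (2) no two members $C,C'$ have a common tangent line meeting $C\cap C'$, and (3) no three members share a common tangent line. The family is noncrossing if no two members share more than two boundary points. $N_3(q,n)$ is the smallest $N$ such that for every coloring of all 3-element subsets of $[N]$ with $q$ colors there are integers $j_1<\dots<j_n$ in $[N]$ such that all triples $\{j_i,j_{i+1},j_{i+2}\}$, $1\le i\le n-2$, receive the same color. *)

theory Defs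
  imports "HOL-Analysis.Analysis"
begin

type_synonym plane = "real ^ 2"

definition convex_body :: "plane set \<Rightarrow> bool" where
  "convex_body C \<longleftrightarrow> compact C \<and> convex C \<and> interior C \<noteq> {}"

definition convex_position :: "plane set set \<Rightarrow> bool" where
  "convex_position F \<longleftrightarrow> (\<forall>C\<in>F. \<not> C \<subseteq> convex hull (\<Union>(F - {C})))"

text \<open>A tangent is a supporting line: it meets \<open>C\<close> and \<open>C\<close> lies on one closed side of it.
  The normal \<open>a\<close> depends on the body, so a common tangent of two bodies may
  have them on the same side or on opposite sides.\<close>

definition tangent_line :: "plane set \<Rightarrow> plane set \<Rightarrow> bool" where
  "tangent_line L C \<longleftrightarrow>
     (\<exists>a b. a \<noteq> 0 \<and> L = {x. a \<bullet> x = b} \<and> L \<inter> C \<noteq> {} \<and> (\<forall>x\<in>C. a \<bullet> x \<le> b))"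

definition general_position :: "plane set set \<Rightarrow> bool" where
  "general_position F \<longleftrightarrow>
     (\<forall>G\<subseteq>F. card G = 3 \<longrightarrow> convex_position G) \<and>
     (\<forall>C\<in>F. \<forall>D\<in>F. C \<noteq> D \<longrightarrow>
        \<not> (\<exists>L. tangent_line L C \<and> tangent_line L D \<and> L \<inter> (C \<inter> D) \<noteq> {})) \<and>
     (\<forall>G\<subseteq>F. card G = 3 \<longrightarrow> \<not> (\<exists>L. \<forall>C\<in>G. tangent_line L C))"

definition noncrossing :: "plane set set \<Rightarrow> bool" where
  "noncrossing F \<longleftrightarrow>
     (\<forall>C\<in>F. \<forall>D\<in>F. C \<noteq> D \<longrightarrow>
        finite (frontier C \<inter> frontier D) \<and> card (frontier C \<inter> frontier D) \<le> 2)"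

text \<open>Families are sets: repeated members would violate general position anyway.\<close>

definition bodies_property :: "nat \<Rightarrow> nat \<Rightarrow> bool" where
  "bodies_property n N \<longleftrightarrow>
     (\<forall>F. finite F \<and> card F = N \<and> (\<forall>C\<in>F. convex_body C) \<and>
          noncrossing F \<and> general_position F \<longrightarrow>
          (\<exists>G\<subseteq>F. card G = n \<and> convex_position G))"

definition M_bodies :: "nat \<Rightarrow> nat" where
  "M_bodies n = (LEAST N. bodies_property n N)"

definition monotone_path_property :: "nat \<Rightarrow> nat \<Rightarrow> nat \<Rightarrow> bool" where
  "monotone_path_property q n N \<longleftrightarrow>
     (\<forall>col :: nat set \<Rightarrow> nat.
        (\<forall>T\<subseteq>{1..N}. card T = 3 \<longrightarrow> col T \<in> {1..q}) \<longrightarrow>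
        (\<exists>j :: nat \<Rightarrow> nat.
           strict_mono_on {1..n} j \<and> j ` {1..n} \<subseteq> {1..N} \<and>
           (\<exists>c. \<forall>i\<in>{1..n - 2}. col {j i, j (i + 1), j (i + 2)} = c)))"

definition N\<^sub>3 :: "nat \<Rightarrow> nat \<Rightarrow> nat" where
  "N\<^sub>3 q n = (LEAST N. monotone_path_property q n N)"

end

theory Submission
  imports Defs
begin

text \<open>Cut the circle of directions open at a direction where the support functions of the bodies
  are pairwise distinct, and number the bodies so that these values decrease. Because the family
  is noncrossing, the directions in which a later body \<open>j\<close> reaches further than an earlier body
  \<open>i\<close> form an open interval \<open>(a i j, b i j)\<close>: otherwise support points of the two bodies
  would alternate along the boundary of their common hull, the segments joining them would cross,
  and the two boundaries would meet at least four times around the crossing point. A family is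
  in convex position iff each member is on the upper envelope of the support functions. Colour a
  triple \<open>i < j < k\<close> according to whether \<open>(a j k, b j k)\<close> is shifted to the right of
  \<open>(a i j, b i j)\<close>, nested in it, or shifted to its left. Along a monochromatic monotone path
  every body is on the envelope: for nested triples this is immediate, and shiftedness is
  transitive, hence passes from consecutive triples to all triples of the path.

  The bound on \<open>N\<^sub>3\<close> comes from counting up-sets of a grid, as in the
  Moshkovitz--Shapira argument.\<close>

section \<open>Monotone paths\<close>

definition monotone_path ::
  "'a::linorder set \<Rightarrow> nat \<Rightarrow> ('a \<Rightarrow> 'a \<Rightarrow> 'a \<Rightarrow> bool) \<Rightarrow> (nat \<Rightarrow> 'a) \<Rightarrow> bool" where
  "monotone_path X n T p \<longleftrightarrow> strict_mono_on {1..n} p \<and> p ` {1..n} \<subseteq> X \<and>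
     (\<forall>r\<in>{1..n - 2}. T (p r) (p (r + 1)) (p (r + 2)))"

lemma monotone_path_less:
  assumes "monotone_path X n T p" "1 \<le> r" "r < s" "s \<le> n"
  shows "p r < p s"
  using assms by (auto simp: monotone_path_def strict_mono_on_def)

lemma monotone_path_mem:
  assumes "monotone_path X n T p" "1 \<le> r" "r \<le> n"
  shows "p r \<in> X"
  using assms by (auto simp: monotone_path_def)

lemma monotone_path_triple:
  assumes "monotone_path X n T p" "1 \<le> r" "r + 2 \<le> n"
  shows "T (p r) (p (r + 1)) (p (r + 2))"
  using assms by (simp add: monotone_path_def)

lemma monotone_path_inj:
  assumes "monotone_path X n T p"
  shows "inj_on p {1..n}"
  using assms by (simp add: monotone_path_def strict_mono_on_imp_inj_on)

lemma monotone_path_mono: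
  assumes p: "monotone_path X n T p"
    and implies: "\<And>x y z. \<lbrakk>x \<in> X; y \<in> X; z \<in> X; x < y; y < z; T x y z\<rbrakk> \<Longrightarrow> T' x y z"
  shows "monotone_path X n T' p"
  unfolding monotone_path_def
proof (intro conjI ballI)
  fix r assume "r \<in> {1..n - 2}"
  then have "1 \<le> r" "r + 2 \<le> n" by auto
  then show "T' (p r) (p (r + 1)) (p (r + 2))"
    by (auto intro!: implies monotone_path_mem[OF p] monotone_path_less[OF p]
        simp: monotone_path_triple[OF p, simplified])
qed (use p in \<open>auto simp: monotone_path_def\<close>)

lemma monotone_path_subset:
  assumes p: "monotone_path X n T p" and "m \<le> n" "X \<subseteq> Y"
  shows "monotone_path Y m T p"
proof -
  have "{1..m} \<subseteq> {1..n}" "{1..m - 2} \<subseteq> {1..n - 2}" using \<open>m \<le> n\<close> by auto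
  then show ?thesis
    using p \<open>X \<subseteq> Y\<close> unfolding monotone_path_def by (blast intro: monotone_on_subset)
qed

lemma monotone_path_snoc:
  assumes p: "monotone_path X n T p"
    and j: "j \<in> X" "p n < j" and T: "T (p (n - 1)) (p n) j"
  shows "monotone_path X (Suc n) T (p(Suc n := j))"
  unfolding monotone_path_def
proof (intro conjI ballI)
  have less: "p r < j" if "1 \<le> r" "r \<le> n" for r
    using monotone_path_less[OF p, of r n] that j by (cases "r = n") auto
  show "strict_mono_on {1..Suc n} (p(Suc n := j))"
    using p less by (auto simp: monotone_path_def strict_mono_on_def le_Suc_eq)
  show "(p(Suc n := j)) ` {1..Suc n} \<subseteq> X"
    using p j by (auto simp: monotone_path_def)
  fix r assume "r \<in> {1..Suc n - 2}"
  then consider (last) "r = n - 1" "n \<ge> 2" | (earlier) "1 \<le> r" "r + 2 \<le> n" by fastforce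
  then show "T ((p(Suc n := j)) r) ((p(Suc n := j)) (r + 1)) ((p(Suc n := j)) (r + 2))"
  proof cases
    case last
    then have "r \<noteq> Suc n" "r + 1 = n" "r + 2 = Suc n" by auto
    then show ?thesis using T last by simp
  next
    case earlier
    then show ?thesis using monotone_path_triple[OF p earlier] by simp
  qed
qed

lemma monotone_path_pairwise:
  assumes p: "monotone_path X n T p"
    and trans: "\<And>i j k l. \<lbrakk>i \<in> X; j \<in> X; k \<in> X; l \<in> X; i < j; j < k; k < l; T i j k; T j k l\<rbrakk>
      \<Longrightarrow> T i j l \<and> T i k l"
    and "1 \<le> r" "r < s" "s < t" "t \<le> n"
  shows "T (p r) (p s) (p t)"
  using assms(3-)
proof (induction "t - r" arbitrary: r s t rule: less_induct)
  case less
  note path = monotone_path_mem[OF p] monotone_path_less[OF p]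
  consider (consecutive) "s = r + 1" "t = r + 2" | (gap_after) "s = r + 1" "r + 2 < t"
    | (gap_before) "r + 1 < s"
    using less.prems by linarith
  then show ?case
  proof cases
    case consecutive
    then show ?thesis unfolding consecutive
      using less.prems by (intro monotone_path_triple[OF p]) auto
  next
    case gap_after
    have "T (p r) (p (r + 1)) (p (r + 2))"
      using gap_after less.prems by (intro monotone_path_triple[OF p]) auto
    moreover have "T (p (r + 1)) (p (r + 2)) (p t)"
      using gap_after less.prems by (intro less.hyps) auto
    ultimately have "T (p r) (p (r + 1)) (p t) \<and> T (p r) (p (r + 2)) (p t)"
      using gap_after less.prems by (intro trans path) auto
    then show ?thesis using gap_after by simp
  next
    case gap_before
    have "T (p r) (p (r + 1)) (p s)" "T (p (r + 1)) (p s) (p t)"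
      using gap_before less.prems by (auto intro!: less.hyps)
    then have "T (p r) (p (r + 1)) (p t) \<and> T (p r) (p s) (p t)"
      using gap_before less.prems by (intro trans path) auto
    then show ?thesis by blast
  qed
qed

lemma monotone_path_property_iff:
  "monotone_path_property q n N \<longleftrightarrow>
     (\<forall>col. (\<forall>S\<subseteq>{1..N}. card S = 3 \<longrightarrow> col S \<in> {1..q}) \<longrightarrow>
       (\<exists>p c. monotone_path {1..N} n (\<lambda>i j k. col {i, j, k} = c) p))"
  unfolding monotone_path_property_def monotone_path_def by (simp only: conj_assoc ex_simps)

lemma monotone_path_property_ordered:
  assumes path: "monotone_path_property q n N"
    and g: "\<And>i j k. g i j k \<in> {1..q}"
  obtains p c where "monotone_path {1..N} n (\<lambda>i j k. g i j k = c) p"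
proof -
  define col where "col S = g (Min S) (Min (S - {Min S})) (Max S)" for S
  have "\<forall>S\<subseteq>{1..N}. card S = 3 \<longrightarrow> col S \<in> {1..q}"
    using g unfolding col_def by blast
  then obtain p c where p: "monotone_path {1..N} n (\<lambda>i j k. col {i, j, k} = c) p"
    using path unfolding monotone_path_property_iff by blast
  have "col {i, j, k} = g i j k" if "i < j" "j < k" for i j k
  proof -
    have "Min {i, j, k} = i" "Max {i, j, k} = k" "{i, j, k} - {i} = {j, k}" "Min {j, k} = j"
      using that by auto
    then show ?thesis by (simp add: col_def)
  qed
  then have "monotone_path {1..N} n (\<lambda>i j k. g i j k = c) p"
    using p by (elim monotone_path_mono) simp
  then show ?thesis by (rule that)
qed

lemma monotone_path_property_imp_le:
  assumes "monotone_path_property q n N" "1 \<le> q"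
  shows "n \<le> N"
proof -
  have "1 \<in> {1..q}" using assms(2) by simp
  then obtain p c where p: "monotone_path {1..N} n (\<lambda>i j k. (1::nat) = c) p"
    by (rule monotone_path_property_ordered[OF assms(1)])
  then have "p ` {1..n} \<subseteq> {1..N}" by (simp add: monotone_path_def)
  then show ?thesis using card_inj_on_le[OF monotone_path_inj[OF p], of "{1..N}"] by simp
qed

section \<open>A bound for monotone paths\<close>

text \<open>The length counts triples: a pair that does not end any triple of colour \<open>c\<close> has
  length \<open>0\<close>.\<close>

fun longest_path :: "(nat set \<Rightarrow> 'c) \<Rightarrow> 'c \<Rightarrow> nat \<Rightarrow> nat \<Rightarrow> nat" where
  "longest_path col c i j =
     Max (insert 0 ((\<lambda>h. Suc (longest_path col c h i)) ` {h \<in> {1..<i}. col {h, i, j} = c}))"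

declare longest_path.simps [simp del]

lemma longest_path_less:
  assumes "1 \<le> i" "i < j"
  shows "longest_path col (col {i, j, k}) i j < longest_path col (col {i, j, k}) j k"
proof -
  have "Suc (longest_path col (col {i, j, k}) i j) \<le> longest_path col (col {i, j, k}) j k"
    unfolding longest_path.simps[of _ _ j k] using assms by (intro Max_ge) auto
  then show ?thesis by simp
qed

lemma longest_path_attained:
  assumes "1 \<le> i" "i < j"
  obtains p where
    "monotone_path {1..j} (longest_path col c i j + 2) (\<lambda>x y z. col {x, y, z} = c) p"
    "p (longest_path col c i j + 1) = i" "p (longest_path col c i j + 2) = j"
  using assms
proof (induction i arbitrary: j thesis rule: less_induct)
  case (less i)
  let ?H = "{h \<in> {1..<i}. col {h, i, j} = c}"
  have "longest_path col c i j \<in> insert 0 ((\<lambda>h. Suc (longest_path col c h i)) ` ?H)"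
    unfolding longest_path.simps[of _ _ i j] by (intro Max_in) auto
  then consider (zero) "longest_path col c i j = 0"
    | (step) h where "h \<in> ?H" "longest_path col c i j = Suc (longest_path col c h i)" by auto
  then show ?case
  proof cases
    case zero
    have "monotone_path {1..j} 2 (\<lambda>x y z. col {x, y, z} = c) (\<lambda>r. if r = 1 then i else j)"
      using less.prems(2,3) by (auto simp: monotone_path_def strict_mono_on_def)
    then show ?thesis using less.prems(1)[of "\<lambda>r. if r = 1 then i else j"] zero
      by (simp add: numeral_2_eq_2)
  next
    case (step h)
    define m where "m = longest_path col c h i"
    obtain p where p: "monotone_path {1..i} (m + 2) (\<lambda>x y z. col {x, y, z} = c) p"
        "p (m + 1) = h" "p (m + 2) = i"
      using less.IH[of h i] step(1) unfolding m_def by auto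
    then have "monotone_path {1..j} (m + 2) (\<lambda>x y z. col {x, y, z} = c) p"
      using less.prems(3) by (intro monotone_path_subset[OF p(1)]) auto
    then have "monotone_path {1..j} (Suc (m + 2)) (\<lambda>x y z. col {x, y, z} = c) (p(Suc (m + 2) := j))"
      using p step(1) less.prems(2,3) by (intro monotone_path_snoc) auto
    then show ?thesis
      using less.prems(1)[of "p(Suc (m + 2) := j)"] step(2) p(3) by (simp add: m_def fun_upd_def)
  qed
qed

definition grid_up_sets :: "'c set \<Rightarrow> nat \<Rightarrow> ('c \<Rightarrow> nat) set set" where
  "grid_up_sets C L = {U. U \<subseteq> C \<rightarrow>\<^sub>E {..<L} \<and>
     (\<forall>x\<in>U. \<forall>y\<in>C \<rightarrow>\<^sub>E {..<L}. (\<forall>c\<in>C. x c \<le> y c) \<longrightarrow> y \<in> U)}"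

lemma finite_grid_up_sets:
  assumes "finite C" shows "finite (grid_up_sets C L)"
  using assms
  by (intro finite_subset[of "grid_up_sets C L" "Pow (C \<rightarrow>\<^sub>E {..<L})"])
    (auto simp: grid_up_sets_def intro: finite_PiE)

text \<open>The value \<open>L\<close> means that the line through \<open>x\<close> in direction \<open>c\<close> misses \<open>U\<close>.\<close>

definition up_set_height :: "'c \<Rightarrow> nat \<Rightarrow> ('c \<Rightarrow> nat) set \<Rightarrow> ('c \<Rightarrow> nat) \<Rightarrow> nat" where
  "up_set_height c L U x = (LEAST t. t = L \<or> x(c := t) \<in> U)"

lemma up_set_height_le: "up_set_height c L U x \<le> L"
  unfolding up_set_height_def by (rule Least_le) simp

lemma mem_grid_up_set_iff:
  assumes U: "U \<in> grid_up_sets C L" and c: "c \<in> C"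
  shows "y \<in> U \<longleftrightarrow>
    y \<in> C \<rightarrow>\<^sub>E {..<L} \<and> up_set_height c L U (restrict y (C - {c})) \<le> y c"
proof (cases "y \<in> C \<rightarrow>\<^sub>E {..<L}")
  case y: True
  define x where "x = restrict y (C - {c})"
  define h where "h = up_set_height c L U x"
  have x_upd: "(x(c := t)) d = (if d = c then t else y d)" for t d
    using y c by (auto simp: x_def PiE_def extensional_def)
  have "y \<in> U" if "h \<le> y c"
  proof -
    have "h = L \<or> x(c := h) \<in> U"
      unfolding h_def up_set_height_def by (rule LeastI[of _ L]) simp
    moreover have "y c < L" using y c by auto
    ultimately have "x(c := h) \<in> U" using that by auto
    moreover have "\<forall>d\<in>C. (x(c := h)) d \<le> y d" using that x_upd by auto
    ultimately show "y \<in> U" using U y unfolding grid_up_sets_def by blast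
  qed
  moreover have "h \<le> y c" if "y \<in> U"
  proof -
    have "x(c := y c) = y" using x_upd by auto
    then show ?thesis unfolding h_def up_set_height_def using that by (intro Least_le) simp
  qed
  ultimately show ?thesis using y by (auto simp: x_def h_def)
qed (use U in \<open>auto simp: grid_up_sets_def\<close>)

lemma card_grid_up_sets_le:
  assumes C: "finite C" "c \<in> C"
  shows "card (grid_up_sets C L) \<le> (L + 1) ^ (L ^ (card C - 1))"
proof -
  let ?X = "C - {c} \<rightarrow>\<^sub>E {..<L}"
  define height where "height U = restrict (up_set_height c L U) ?X" for U
  have mem_iff: "y \<in> U \<longleftrightarrow> y \<in> C \<rightarrow>\<^sub>E {..<L} \<and> height U (restrict y (C - {c})) \<le> y c"
    if "U \<in> grid_up_sets C L" for y U
    using mem_grid_up_set_iff[OF that C(2), of y] by (auto simp: height_def)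
  have "inj_on height (grid_up_sets C L)"
    by (intro inj_onI set_eqI) (simp add: mem_iff)
  moreover have "height ` grid_up_sets C L \<subseteq> ?X \<rightarrow>\<^sub>E {..L}"
    by (intro image_subsetI) (simp add: height_def up_set_height_le)
  moreover have "finite (?X \<rightarrow>\<^sub>E {..L})" using C by (intro finite_PiE) auto
  ultimately have "card (grid_up_sets C L) \<le> card (?X \<rightarrow>\<^sub>E {..L})" by (rule card_inj_on_le)
  also have "\<dots> = (L + 1) ^ (L ^ (card C - 1))"
    using C by (simp add: card_PiE finite_PiE)
  finally show ?thesis .
qed

text \<open>The label vectors of the pairs starting at \<open>i\<close> generate an up-set, and these up-sets are
  pairwise distinct.\<close>

lemma le_if_increasing_labels:
  assumes C: "finite C" "C \<noteq> {}"
    and bound: "\<And>c i j. \<lbrakk>c \<in> C; 1 \<le> i; i < j; j \<le> N\<rbrakk> \<Longrightarrow> v c i j < L"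
    and step: "\<And>i j k. \<lbrakk>1 \<le> i; i < j; j < k; k \<le> N\<rbrakk> \<Longrightarrow> \<exists>c\<in>C. v c i j < v c j k"
  shows "N \<le> (L + 1) ^ (L ^ (card C - 1))"
proof -
  obtain c where "c \<in> C" using C by blast
  define U where "U i = {x \<in> C \<rightarrow>\<^sub>E {..<L}. \<exists>k\<in>{i<..N}. \<forall>c\<in>C. v c i k \<le> x c}" for i
  have "U i \<noteq> U j" if ij: "1 \<le> i" "i < j" "j \<le> N" for i j
  proof
    assume same: "U i = U j"
    have "(\<lambda>c\<in>C. v c i j) \<in> U i" using bound ij by (auto simp: U_def)
    then obtain k where "j < k" "k \<le> N" "\<forall>c\<in>C. v c j k \<le> v c i j"
      unfolding same by (auto simp: U_def)
    then show False using step[of i j k] ij by force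
  qed
  then have "inj_on U {1..N}" by (intro linorder_inj_onI) auto
  moreover have "U ` {1..N} \<subseteq> grid_up_sets C L"
  proof (rule image_subsetI)
    fix i show "U i \<in> grid_up_sets C L"
      unfolding grid_up_sets_def U_def by auto (meson greaterThanAtMost_iff order_trans)
  qed
  ultimately have "card {1..N} \<le> card (grid_up_sets C L)"
    using finite_grid_up_sets[OF C(1)] by (rule card_inj_on_le)
  also have "\<dots> \<le> (L + 1) ^ (L ^ (card C - 1))"
    by (rule card_grid_up_sets_le[OF C(1) \<open>c \<in> C\<close>])
  finally show ?thesis by simp
qed

lemma monotone_path_property_large:
  assumes "1 \<le> q" and n: "2 \<le> n" and N: "(n - 1) ^ ((n - 2) ^ (q - 1)) < N"
  shows "monotone_path_property q n N"
  unfolding monotone_path_property_iff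
proof (intro allI impI, rule ccontr)
  fix col :: "nat set \<Rightarrow> nat"
  assume col: "\<forall>S\<subseteq>{1..N}. card S = 3 \<longrightarrow> col S \<in> {1..q}"
  assume no_path: "\<nexists>p c. monotone_path {1..N} n (\<lambda>i j k. col {i, j, k} = c) p"
  have "longest_path col c i j < n - 2" if ij: "1 \<le> i" "i < j" "j \<le> N" for c i j
  proof (rule ccontr)
    assume "\<not> longest_path col c i j < n - 2"
    moreover obtain p where
      "monotone_path {1..j} (longest_path col c i j + 2) (\<lambda>i j k. col {i, j, k} = c) p"
      using longest_path_attained[OF ij(1,2), where col = col and c = c] by blast
    ultimately have "monotone_path {1..N} n (\<lambda>i j k. col {i, j, k} = c) p"
      using ij by (elim monotone_path_subset) auto
    then show False using no_path by blast
  qed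
  moreover have "\<exists>c\<in>{1..q}. longest_path col c i j < longest_path col c j k"
    if ijk: "1 \<le> i" "i < j" "j < k" "k \<le> N" for i j k
  proof
    have "card {i, j, k} = 3" "{i, j, k} \<subseteq> {1..N}" using ijk by auto
    then show "col {i, j, k} \<in> {1..q}" using col by blast
  qed (rule longest_path_less[OF ijk(1,2)])
  ultimately have "N \<le> (n - 2 + 1) ^ ((n - 2) ^ (card {1..q} - 1))"
    using \<open>1 \<le> q\<close> by (intro le_if_increasing_labels[of _ _ "longest_path col"]) auto
  moreover have "n - 2 + 1 = n - 1" using n by simp
  ultimately show False using N by simp
qed

lemma monotone_path_property_3:
  assumes "3 \<le> n"
  shows "monotone_path_property 3 n (n ^ n\<^sup>2)"
proof (rule monotone_path_property_large)
  have "(n - 1) ^ ((n - 2) ^ (3 - 1)) \<le> n ^ ((n - 2) ^ (3 - 1))"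
    by (intro power_mono) auto
  also have "\<dots> < n ^ n\<^sup>2"
    using assms by (intro power_strict_increasing) (auto intro: power_strict_mono)
  finally show "(n - 1) ^ ((n - 2) ^ (3 - 1)) < n ^ n\<^sup>2" .
qed (use assms in auto)

section \<open>Upper envelopes\<close>

definition on_upper_envelope :: "('a \<Rightarrow> 'b \<Rightarrow> 'c::ord) \<Rightarrow> 'b set \<Rightarrow> 'a set \<Rightarrow> 'a \<Rightarrow> bool" where
  "on_upper_envelope f D Y k \<longleftrightarrow> (\<exists>t\<in>D. \<forall>i\<in>Y - {k}. f i t < f k t)"

definition overtakes_between ::
  "real \<Rightarrow> real \<Rightarrow> real \<Rightarrow> real \<Rightarrow> (real \<Rightarrow> real) \<Rightarrow> (real \<Rightarrow> real) \<Rightarrow> bool" where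
  "overtakes_between u v a b f g \<longleftrightarrow> u < a \<and> a < b \<and> b < v \<and>
     (\<forall>t\<in>{u..v}. (f t < g t \<longleftrightarrow> a < t \<and> t < b) \<and> (g t < f t \<longleftrightarrow> t < a \<or> b < t))"

lemma on_upper_envelope_reindex:
  assumes "inj_on B Y" "k \<in> Y"
  shows "on_upper_envelope (\<lambda>i. f (B i)) D Y k \<longleftrightarrow> on_upper_envelope f D (B ` Y) (B k)"
proof -
  have "B ` Y - {B k} = B ` (Y - {k})" using assms by (auto dest: inj_onD)
  then show ?thesis by (simp add: on_upper_envelope_def)
qed

lemma on_upper_envelope_reflect:
  fixes u v :: real
  shows "on_upper_envelope (\<lambda>i t. f i (u + v - t)) {u..v} Y k \<longleftrightarrow> on_upper_envelope f {u..v} Y k"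
proof -
  have "(\<lambda>t. u + v - t) ` {u..v} = {u..v}" by simp
  then have "(\<exists>t\<in>{u..v}. P (u + v - t)) \<longleftrightarrow> (\<exists>t\<in>{u..v}. P t)" for P
    using bex_simps(7)[of "\<lambda>t. u + v - t" "{u..v}" P] by simp
  then show ?thesis by (simp add: on_upper_envelope_def)
qed

lemma overtakes_between_reflect:
  assumes "overtakes_between u v a b f g"
  shows "overtakes_between u v (u + v - b) (u + v - a) (\<lambda>t. f (u + v - t)) (\<lambda>t. g (u + v - t))"
  unfolding overtakes_between_def
proof (intro conjI ballI)
  fix t assume "t \<in> {u..v}"
  then have "u + v - t \<in> {u..v}" by auto
  then have "f (u + v - t) < g (u + v - t) \<longleftrightarrow> a < u + v - t \<and> u + v - t < b"
    "g (u + v - t) < f (u + v - t) \<longleftrightarrow> u + v - t < a \<or> b < u + v - t"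
    using assms unfolding overtakes_between_def by blast+
  then show "f (u + v - t) < g (u + v - t) \<longleftrightarrow> u + v - b < t \<and> t < u + v - a"
    "g (u + v - t) < f (u + v - t) \<longleftrightarrow> t < u + v - b \<or> u + v - a < t"
    by auto
qed (use assms in \<open>auto simp: overtakes_between_def\<close>)

lemma finite_sets_separated:
  fixes A B :: "'a::dense_linorder set"
  assumes "finite A" "A \<noteq> {}" "finite B" "B \<noteq> {}" "\<And>x y. \<lbrakk>x \<in> A; y \<in> B\<rbrakk> \<Longrightarrow> x < y"
  obtains t where "\<And>x. x \<in> A \<Longrightarrow> x < t" "\<And>y. y \<in> B \<Longrightarrow> t < y"
proof -
  have "Max A < Min B" using assms by simp
  then obtain t where "Max A < t" "t < Min B" using dense by blast
  then show ?thesis using that[of t] assms by simp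
qed

lemma unimodal_less_peak:
  fixes g :: "nat \<Rightarrow> 'a::ordered_ab_group_add"
  assumes up: "\<And>r. \<lbrakk>1 \<le> r; r < m\<rbrakk> \<Longrightarrow> g r < g (Suc r)"
    and down: "\<And>r. \<lbrakk>m \<le> r; r < n\<rbrakk> \<Longrightarrow> g (Suc r) < g r"
    and i: "1 \<le> i" "i \<le> n" "i \<noteq> m"
  shows "g i < g m"
proof (cases "i < m")
  case True
  then show ?thesis using lift_Suc_mono_less_ivl[of "{1..<m}" g i m] up i(1) by auto
next
  case False
  then have "- g m < - g i"
    using lift_Suc_mono_less_ivl[of "{m..<n}" "\<lambda>r. - g r" m i] down i by auto
  then show ?thesis by simp
qed

locale pseudoparabolas =
  fixes X :: "'a::linorder set" and u v :: real
    and f :: "'a \<Rightarrow> real \<Rightarrow> real" and a b :: "'a \<Rightarrow> 'a \<Rightarrow> real"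
  assumes u_less_v: "u < v"
    and overtakes: "\<lbrakk>i \<in> X; j \<in> X; i < j\<rbrakk> \<Longrightarrow> overtakes_between u v (a i j) (b i j) (f i) (f j)"
    and no_common_value: "\<lbrakk>i \<in> X; j \<in> X; k \<in> X; i < j; j < k; t \<in> {u..v}\<rbrakk>
        \<Longrightarrow> \<not> (f i t = f j t \<and> f j t = f k t)"
    and middle_on_envelope: "\<lbrakk>i \<in> X; j \<in> X; k \<in> X; i < j; j < k\<rbrakk>
        \<Longrightarrow> on_upper_envelope f {u..v} {i, j, k} j"
    and last_on_envelope: "\<lbrakk>i \<in> X; j \<in> X; k \<in> X; i < j; j < k\<rbrakk>
        \<Longrightarrow> on_upper_envelope f {u..v} {i, j, k} k"
begin

lemma ends:
  assumes "i \<in> X" "j \<in> X" "i < j"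
  shows "u < a i j" "a i j < b i j" "b i j < v"
  using overtakes[OF assms] by (auto simp: overtakes_between_def)

lemma ends_mem:
  assumes "i \<in> X" "j \<in> X" "i < j"
  shows "a i j \<in> {u..v}" "b i j \<in> {u..v}"
  using ends[OF assms] by auto

lemma less_iff:
  assumes "i \<in> X" "j \<in> X" "i < j" "t \<in> {u..v}"
  shows "f i t < f j t \<longleftrightarrow> a i j < t \<and> t < b i j"
  using overtakes[OF assms(1-3)] assms(4) by (simp add: overtakes_between_def)

lemma greater_iff:
  assumes "i \<in> X" "j \<in> X" "i < j" "t \<in> {u..v}"
  shows "f j t < f i t \<longleftrightarrow> t < a i j \<or> b i j < t"
  using overtakes[OF assms(1-3)] assms(4) by (simp add: overtakes_between_def)

lemma eq_at_ends:
  assumes "i \<in> X" "j \<in> X" "i < j"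
  shows "f i (a i j) = f j (a i j)" "f i (b i j) = f j (b i j)"
  using less_iff[OF assms] greater_iff[OF assms] ends_mem[OF assms] ends[OF assms]
  by (metis less_irrefl linorder_cases order.asym)+

lemma ends_neq:
  assumes "i \<in> X" "j \<in> X" "k \<in> X" "i < j" "j < k"
  shows "a i j \<noteq> a j k" "b i j \<noteq> b j k"
  using no_common_value[OF assms] eq_at_ends[of i j] eq_at_ends[of j k] ends_mem[of i j] assms
  by metis+

lemma intervals_of_last_overlap:
  assumes "i \<in> X" "j \<in> X" "k \<in> X" "i < j" "j < k"
  shows "a i k < b j k" "a j k < b i k"
proof -
  obtain t where "t \<in> {u..v}" "f i t < f k t" "f j t < f k t"
    using last_on_envelope[OF assms] assms by (auto simp: on_upper_envelope_def)
  then show "a i k < b j k" "a j k < b i k"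
    using less_iff[of i k t] less_iff[of j k t] assms by auto
qed

lemma first_interval_not_covered:
  assumes "i \<in> X" "j \<in> X" "k \<in> X" "i < j" "j < k"
  obtains t where "a i j < t" "t < b i j" "t < a j k \<or> b j k < t"
proof -
  obtain t where "t \<in> {u..v}" "f i t < f j t" "f k t < f j t"
    using middle_on_envelope[OF assms] assms by (auto simp: on_upper_envelope_def)
  then show ?thesis using that less_iff[of i j t] greater_iff[of j k t] assms by blast
qed

definition shifted :: "'a \<Rightarrow> 'a \<Rightarrow> 'a \<Rightarrow> bool" where
  "shifted i j k \<longleftrightarrow> a i j < a j k \<and> b i j < b j k"

definition nested :: "'a \<Rightarrow> 'a \<Rightarrow> 'a \<Rightarrow> bool" where
  "nested i j k \<longleftrightarrow> a i j < a j k \<and> b j k < b i j"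

lemma shifted_right_ends_less:
  assumes "i \<in> X" "j \<in> X" "k \<in> X" "i < j" "j < k" "shifted i j k"
  shows "b i k < b j k"
proof -
  have "f j (b j k) < f i (b j k)"
    using greater_iff[of i j "b j k"] assms ends_mem[of j k] by (auto simp: shifted_def)
  then have "f k (b j k) < f i (b j k)" using eq_at_ends[of j k] assms by simp
  then have "b j k < a i k \<or> b i k < b j k"
    using greater_iff[of i k "b j k"] assms ends_mem[of j k] by auto
  then show ?thesis using intervals_of_last_overlap[OF assms(1-5)] by auto
qed

lemma shifted_skip_second:
  assumes "i \<in> X" "j \<in> X" "k \<in> X" "l \<in> X" "i < j" "j < k" "k < l"
    and "shifted i j k" "shifted j k l"
  shows "shifted i k l"
proof -
  have "b i k < b j k" using assms by (intro shifted_right_ends_less) auto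
  also have "\<dots> < b k l" using assms(9) by (simp add: shifted_def)
  finally have right_ends: "b i k < b k l" .
  have "i < k" using assms by order
  then obtain t where "a i k < t" "t < b i k" "t < a k l \<or> b k l < t"
    using first_interval_not_covered[of i k l] assms by blast
  then have "a i k < a k l" using right_ends by auto
  then show ?thesis using right_ends by (simp add: shifted_def)
qed

lemma shifted_skip_third:
  assumes X: "i \<in> X" "j \<in> X" "k \<in> X" "l \<in> X" and less: "i < j" "j < k" "k < l"
    and "shifted i j k" "shifted j k l"
  shows "shifted i j l"
  unfolding shifted_def
proof
  note ordered = X less less_trans[OF less(2,3)]
  have shift: "a i j < a j k" "b i j < b j k" "a j k < a k l" "b j k < b k l"
    using assms(8,9) by (auto simp: shifted_def)
  show "a i j < a j l"
  proof (rule ccontr)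
    assume not_less: "\<not> a i j < a j l"
    then have "f k (a j l) < f j (a j l)"
      using greater_iff[of j k "a j l"] ordered ends_mem[of j l] shift by auto
    then have "f k (a j l) < f l (a j l)" using eq_at_ends[of j l] ordered by simp
    then show False using less_iff[of k l "a j l"] ordered ends_mem[of j l] not_less shift by auto
  qed
  show "b i j < b j l"
  proof (rule ccontr)
    assume not_less: "\<not> b i j < b j l"
    have "a k l < b j l" using intervals_of_last_overlap[of j k l] ordered by auto
    then have "f j (b j l) < f k (b j l)" "\<not> f l (b j l) < f k (b j l)"
      using less_iff[of j k "b j l"] greater_iff[of k l "b j l"] ordered ends_mem[of j l] shift
        not_less by auto
    then show False using eq_at_ends[of j l] ordered by simp
  qed
qed

lemma on_upper_envelope_if_left_ends_less:
  assumes Y: "Y \<subseteq> X" "finite Y" and k: "k \<in> Y"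
    and less: "\<And>i l. \<lbrakk>i \<in> Y; l \<in> Y; i < k; k < l\<rbrakk> \<Longrightarrow> a i k < a k l"
  shows "on_upper_envelope f {u..v} Y k"
proof -
  define A where "A = insert u ((\<lambda>i. a i k) ` {i \<in> Y. i < k})"
  define B where "B = insert v ((\<lambda>i. b i k) ` {i \<in> Y. i < k} \<union> (\<lambda>l. a k l) ` {l \<in> Y. k < l})"
  have inX: "i \<in> X" if "i \<in> Y" for i using that Y by auto
  have before: "u < a i k" "a i k < b i k" "b i k < v" if "i \<in> Y" "i < k" for i
    using ends[of i k] inX k that by auto
  have after: "u < a k l" if "l \<in> Y" "k < l" for l using ends[of k l] inX k that by auto
  have overlap: "a i k < b j k" if "i \<in> Y" "j \<in> Y" "i < k" "j < k" for i j
    using intervals_of_last_overlap[of i j k] intervals_of_last_overlap[of j i k]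
      before(2)[of i] that inX k by (cases i j rule: linorder_cases) auto
  have "x < y" if "x \<in> A" "y \<in> B" for x y
    using that u_less_v overlap less after less_trans[OF before(1,2)] less_trans[OF before(2,3)]
    unfolding A_def B_def by auto
  moreover have "finite A" "finite B" using Y by (auto simp: A_def B_def)
  ultimately obtain t where t: "\<And>x. x \<in> A \<Longrightarrow> x < t" "\<And>y. y \<in> B \<Longrightarrow> t < y"
    using finite_sets_separated[of A B] by (metis A_def B_def insert_not_empty)
  have t_mem: "t \<in> {u..v}" using t(1)[of u] t(2)[of v] by (auto simp: A_def B_def)
  have "f i t < f k t" if "i \<in> Y - {k}" for i
  proof (cases "i < k")
    case True
    then have "a i k \<in> A" "b i k \<in> B" using that by (auto simp: A_def B_def)
    then show ?thesis using t less_iff[of i k t] t_mem inX that k True by auto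
  next
    case False
    then have "a k i \<in> B" "k < i" using that by (auto simp: B_def)
    then show ?thesis using t greater_iff[of k i t] t_mem inX that k by auto
  qed
  then show ?thesis using t_mem unfolding on_upper_envelope_def by blast
qed

lemma on_upper_envelope_if_shifted_path:
  assumes p: "monotone_path X n shifted p" and k: "k \<in> p ` {1..n}"
  shows "on_upper_envelope f {u..v} (p ` {1..n}) k"
proof (rule on_upper_envelope_if_left_ends_less[OF _ _ k])
  show "p ` {1..n} \<subseteq> X" using p by (simp add: monotone_path_def)
  obtain m where m: "m \<in> {1..n}" "k = p m" using k by blast
  have index_less: "r < s" if "p r < p s" "r \<in> {1..n}" "s \<in> {1..n}" for r s
    using monotone_path_less[OF p, of s r] that by (cases r s rule: linorder_cases) auto
  fix i l assume il: "i \<in> p ` {1..n}" "l \<in> p ` {1..n}" "i < k" "k < l"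
  then obtain r s where rs: "i = p r" "l = p s" "r \<in> {1..n}" "s \<in> {1..n}" by blast
  have "shifted (p r) (p m) (p s)"
  proof (rule monotone_path_pairwise[OF p])
    show "shifted h i l \<and> shifted h k l"
      if "h \<in> X" "i \<in> X" "k \<in> X" "l \<in> X" "h < i" "i < k" "k < l" "shifted h i k" "shifted i k l"
      for h i k l
      using shifted_skip_second[OF that] shifted_skip_third[OF that] by blast
  qed (use index_less[of r m] index_less[of m s] rs il m in auto)
  then show "a i k < a k l" using rs m by (simp add: shifted_def)
qed simp

lemma nested_path_ends:
  assumes p: "monotone_path X n nested p" and "1 \<le> r" "r \<le> s" "s < n"
  shows "a (p r) (p (Suc r)) \<le> a (p s) (p (Suc s))" "b (p s) (p (Suc s)) \<le> b (p r) (p (Suc r))"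
proof -
  have step: "a (p q) (p (Suc q)) \<le> a (p (Suc q)) (p (Suc (Suc q))) \<and>
      b (p (Suc q)) (p (Suc (Suc q))) \<le> b (p q) (p (Suc q))" if "q \<in> {r..<s}" for q
    using monotone_path_triple[OF p, of q] that assms(2-) by (simp add: nested_def)
  show "a (p r) (p (Suc r)) \<le> a (p s) (p (Suc s))"
    by (rule lift_Suc_mono_le_ivl[of "{r..<s}"]) (use step assms in blast)+
  show "b (p s) (p (Suc s)) \<le> b (p r) (p (Suc r))"
    by (rule lift_Suc_antimono_le_ivl[of "{r..<s}"]) (use step assms in blast)+
qed

lemma nested_path_separating_point:
  assumes p: "monotone_path X n nested p" and m: "1 \<le> m" "m \<le> n"
  obtains t where "t \<in> {u..v}" "m < n \<Longrightarrow> t < a (p m) (p (Suc m))"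
    "1 < m \<Longrightarrow> a (p (m - 1)) (p m) < t \<and> t < b (p (m - 1)) (p m)"
proof -
  define lo where "lo = (if 1 < m then a (p (m - 1)) (p m) else u)"
  define hi where "hi = (if 1 < m then b (p (m - 1)) (p m) else v)"
  define hi' where "hi' = (if m < n then a (p m) (p (Suc m)) else v)"
  note path = monotone_path_mem[OF p] monotone_path_less[OF p]
  have before: "u < a (p (m - 1)) (p m)" "a (p (m - 1)) (p m) < b (p (m - 1)) (p m)"
      "b (p (m - 1)) (p m) < v" if "1 < m"
    using that m by (auto intro!: ends path)
  have after: "u < a (p m) (p (Suc m))" "a (p m) (p (Suc m)) < v" if "m < n"
    using that m ends[of "p m" "p (Suc m)"] path[of m] path(1)[of "Suc m"] by auto
  have "a (p (m - 1)) (p m) < a (p m) (p (Suc m))" if "1 < m" "m < n"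
    using monotone_path_triple[OF p, of "m - 1"] that by (simp add: nested_def)
  then have "lo < min hi hi'"
    using before after u_less_v by (auto simp: lo_def hi_def hi'_def)
  then obtain t where "lo < t" "t < min hi hi'" using dense by blast
  moreover have "u \<le> lo" "hi' \<le> v"
    using before after by (auto simp: lo_def hi'_def intro: less_imp_le)
  ultimately show ?thesis
    using that[of t] by (auto simp: lo_def hi_def hi'_def split: if_splits)
qed

lemma on_upper_envelope_if_nested_path:
  assumes p: "monotone_path X n nested p" and k: "k \<in> p ` {1..n}"
  shows "on_upper_envelope f {u..v} (p ` {1..n}) k"
proof -
  obtain m where m: "1 \<le> m" "m \<le> n" "k = p m" using k by auto
  obtain t where t: "t \<in> {u..v}" "m < n \<Longrightarrow> t < a (p m) (p (Suc m))"
      "1 < m \<Longrightarrow> a (p (m - 1)) (p m) < t \<and> t < b (p (m - 1)) (p m)"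
    using nested_path_separating_point[OF p m(1,2)] by blast
  have step: "p r \<in> X" "p (Suc r) \<in> X" "p r < p (Suc r)" if "1 \<le> r" "r < n" for r
    using that by (auto intro: monotone_path_mem[OF p] monotone_path_less[OF p])
  have "f (p r) t < f (p (Suc r)) t" if r: "1 \<le> r" "r < m" for r
  proof -
    have "r \<le> m - 1" "m - 1 < n" "Suc (m - 1) = m" using r m by auto
    then have "a (p r) (p (Suc r)) < t" "t < b (p r) (p (Suc r))"
      using nested_path_ends[OF p r(1), of "m - 1"] r t(3) by auto
    then show ?thesis using less_iff[OF step t(1), of r] r m by auto
  qed
  moreover have "f (p (Suc r)) t < f (p r) t" if r: "m \<le> r" "r < n" for r
    using greater_iff[OF step t(1), of r] nested_path_ends[OF p m(1) r] r m t(2) by auto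
  ultimately have "f (p i) t < f (p m) t" if "1 \<le> i" "i \<le> n" "i \<noteq> m" for i
    by (rule unimodal_less_peak[of m "\<lambda>i. f (p i) t" n]) (use that in auto)
  then have "\<forall>i\<in>p ` {1..n} - {k}. f i t < f k t"
    using m(3) by (metis DiffE atLeastAtMost_iff imageE singletonI)
  then show ?thesis using t(1) unfolding on_upper_envelope_def by blast
qed

lemma pseudoparabolas_reflect:
  "pseudoparabolas X u v (\<lambda>i t. f i (u + v - t)) (\<lambda>i j. u + v - b i j) (\<lambda>i j. u + v - a i j)"
proof
  show "\<not> (f i (u + v - t) = f j (u + v - t) \<and> f j (u + v - t) = f k (u + v - t))"
    if "i \<in> X" "j \<in> X" "k \<in> X" "i < j" "j < k" "t \<in> {u..v}" for i j k t
    using no_common_value[OF that(1-5), of "u + v - t"] that(6) by auto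
qed (simp_all only: on_upper_envelope_reflect u_less_v overtakes_between_reflect overtakes
    middle_on_envelope last_on_envelope)

text \<open>The upper envelope of \<open>i, j, k\<close> reads \<open>j\<close> before \<open>k\<close> only (1), \<open>j\<close> both before and after
  \<open>k\<close> (2), or \<open>j\<close> after \<open>k\<close> only (3).\<close>

definition pattern :: "'a \<Rightarrow> 'a \<Rightarrow> 'a \<Rightarrow> nat" where
  "pattern i j k = (if shifted i j k then 1 else if nested i j k then 2 else 3)"

lemma pattern_eq_1_iff: "pattern i j k = 1 \<longleftrightarrow> shifted i j k"
  by (simp add: pattern_def)

lemma pattern_eq_2_iff: "pattern i j k = 2 \<longleftrightarrow> nested i j k"
  by (auto simp: pattern_def shifted_def nested_def)

lemma pattern_eq_3D:
  assumes "i \<in> X" "j \<in> X" "k \<in> X" "i < j" "j < k" "pattern i j k = 3"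
  shows "a j k < a i j" "b j k < b i j"
proof -
  obtain t where "a i j < t" "t < b i j" "t < a j k \<or> b j k < t"
    using first_interval_not_covered[OF assms(1-5)] by blast
  then show "a j k < a i j" "b j k < b i j"
    using ends_neq[OF assms(1-5)] assms(6)
    by (auto simp: pattern_def shifted_def nested_def split: if_splits)
qed

lemma on_upper_envelope_if_pattern_path:
  assumes p: "monotone_path X n (\<lambda>i j k. pattern i j k = c) p" and "3 \<le> n"
    and k: "k \<in> p ` {1..n}"
  shows "on_upper_envelope f {u..v} (p ` {1..n}) k"
proof -
  have "pattern (p 1) (p (1 + 1)) (p (1 + 2)) = c"
    using monotone_path_triple[OF p, of 1] \<open>3 \<le> n\<close> by simp
  moreover have "pattern i j k \<in> {1, 2, 3}" for i j k by (simp add: pattern_def)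
  ultimately have "c \<in> {1, 2, 3}" by metis
  then consider (right) "c = 1" | (inside) "c = 2" | (left) "c = 3" by blast
  then show ?thesis
  proof cases
    case right
    have "monotone_path X n shifted p" using p unfolding right pattern_eq_1_iff .
    then show ?thesis using k by (rule on_upper_envelope_if_shifted_path)
  next
    case inside
    have "monotone_path X n nested p" using p unfolding inside pattern_eq_2_iff .
    then show ?thesis using k by (rule on_upper_envelope_if_nested_path)
  next
    case left
    interpret reflected: pseudoparabolas X u v
        "\<lambda>i t. f i (u + v - t)" "\<lambda>i j. u + v - b i j" "\<lambda>i j. u + v - a i j"
      by (rule pseudoparabolas_reflect)
    have "monotone_path X n reflected.shifted p"
    proof (rule monotone_path_mono[OF p])
      show "reflected.shifted i j k"
        if "i \<in> X" "j \<in> X" "k \<in> X" "i < j" "j < k" "pattern i j k = c" for i j k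
        using pattern_eq_3D[OF that(1-5)] that(6) left by (simp add: reflected.shifted_def)
    qed
    then have "on_upper_envelope (\<lambda>i t. f i (u + v - t)) {u..v} (p ` {1..n}) k"
      using k by (rule reflected.on_upper_envelope_if_shifted_path)
    then show ?thesis by (simp only: on_upper_envelope_reflect)
  qed
qed

end

lemma pseudoparabolas_subset_on_envelope:
  assumes "pseudoparabolas {1..N} u v f a b" "monotone_path_property 3 n N" "3 \<le> n"
  obtains Y where "Y \<subseteq> {1..N}" "card Y = n" "\<And>k. k \<in> Y \<Longrightarrow> on_upper_envelope f {u..v} Y k"
proof -
  interpret pseudoparabolas "{1..N}" u v f a b by fact
  have "pattern i j k \<in> {1..3}" for i j k by (simp add: pattern_def)
  then obtain p c where p: "monotone_path {1..N} n (\<lambda>i j k. pattern i j k = c) p"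
    using monotone_path_property_ordered[OF assms(2)] by blast
  show ?thesis
  proof
    show "p ` {1..n} \<subseteq> {1..N}" using p by (simp add: monotone_path_def)
    show "card (p ` {1..n}) = n" using monotone_path_inj[OF p] by (simp add: card_image)
  qed (rule on_upper_envelope_if_pattern_path[OF p \<open>3 \<le> n\<close>])
qed

section \<open>Crossing segments\<close>

lemma convex_ray_mem:
  fixes x e :: "'a::real_vector"
  assumes "convex S" "x \<in> S" "x + d *\<^sub>R e \<in> S" "0 \<le> c" "c \<le> d"
  shows "x + c *\<^sub>R e \<in> S"
proof (cases "d = 0")
  case False
  then have "0 < d" using assms by linarith
  then have "(1 - c / d) *\<^sub>R x + (c / d) *\<^sub>R (x + d *\<^sub>R e) \<in> S"
    using assms by (intro convexD) auto
  then show ?thesis using False by (simp add: algebra_simps)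
qed (use assms in auto)

lemma convex_ray_interior:
  fixes x e :: "'a::euclidean_space"
  assumes "convex S" "x \<in> interior S" "x + d *\<^sub>R e \<in> S" "0 \<le> c" "c < d"
  shows "x + c *\<^sub>R e \<in> interior S"
proof -
  have "x + d *\<^sub>R e - (1 - c / d) *\<^sub>R (x + d *\<^sub>R e - x) \<in> interior S"
    using assms by (intro mem_interior_convex_shrink) auto
  then show ?thesis using assms by (simp add: algebra_simps)
qed

lemma ray_not_in_both_differences:
  fixes x e :: "'a::real_vector"
  assumes "convex C" "convex D" "x \<in> C" "x \<in> D"
    and "x + c *\<^sub>R e \<in> C - D" "x + d *\<^sub>R e \<in> D - C" "0 \<le> c" "0 \<le> d"
  shows False
  using convex_ray_mem[of D x d e c] convex_ray_mem[of C x c e d] assms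
  by (cases "c \<le> d") auto

lemma ray_exit_interior:
  fixes x e :: "'a::euclidean_space"
  assumes "convex C" "convex D" "x \<in> interior C" "x \<in> D"
    and "x + e \<in> C - D" "x + d *\<^sub>R e \<in> D" "0 \<le> d"
  shows "x + d *\<^sub>R e \<in> interior C"
proof -
  have "d < 1" using convex_ray_mem[of D x d e 1] assms by force
  then show ?thesis using convex_ray_interior[of C x 1 e d] assms by simp
qed

lemma frontier_on_ray_unique:
  fixes x e :: "'a::euclidean_space"
  assumes "convex S" "closed S" "x \<in> interior S" "0 < c" "0 < d"
    and "x + c *\<^sub>R e \<in> frontier S" "x + d *\<^sub>R e \<in> frontier S"
  shows "c = d"
  using assms(4-)
proof (induction c d rule: linorder_less_wlog)
  case (less c d)
  then have "x + c *\<^sub>R e \<in> interior S"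
    using assms(1-3) frontier_subset_closed by (intro convex_ray_interior[of S x d]) auto
  then show ?case using less by (simp add: frontier_def)
qed auto

lemma closed_directions_hitting:
  fixes x :: "'a::real_normed_vector"
  assumes K: "compact K" "x \<notin> K" and T: "closed T" "0 \<notin> T"
  shows "closed {w \<in> T. \<exists>d>0. x + d *\<^sub>R w \<in> K}"
proof -
  have "{w \<in> T. \<exists>d>0. x + d *\<^sub>R w \<in> K} = T \<inter> sgn -` ((\<lambda>y. sgn (y - x)) ` K)"
  proof (intro equalityI subsetI)
    fix w assume "w \<in> {w \<in> T. \<exists>d>0. x + d *\<^sub>R w \<in> K}"
    then obtain d where "w \<in> T" "0 < d" "x + d *\<^sub>R w \<in> K" by blast
    then show "w \<in> T \<inter> sgn -` ((\<lambda>y. sgn (y - x)) ` K)"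
      by (auto simp: sgn_scaleR intro!: image_eqI[of _ _ "x + d *\<^sub>R w"])
  next
    fix w assume "w \<in> T \<inter> sgn -` ((\<lambda>y. sgn (y - x)) ` K)"
    then obtain y where y: "w \<in> T" "y \<in> K" "sgn w = sgn (y - x)" by auto
    then have "w \<noteq> 0" "y \<noteq> x" using K T by auto
    have "(norm (y - x) / norm w) *\<^sub>R w = norm (y - x) *\<^sub>R sgn w"
      by (simp add: sgn_div_norm divide_inverse)
    also have "\<dots> = y - x" using y(3) \<open>y \<noteq> x\<close> by (simp add: sgn_div_norm)
    finally have "x + (norm (y - x) / norm w) *\<^sub>R w = y" by simp
    then show "w \<in> {w \<in> T. \<exists>d>0. x + d *\<^sub>R w \<in> K}"
      using y \<open>w \<noteq> 0\<close> \<open>y \<noteq> x\<close> by (auto intro!: exI[of _ "norm (y - x) / norm w"])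
  qed
  moreover have "closed ((\<lambda>y. sgn (y - x)) ` K)"
    using K by (intro compact_imp_closed compact_continuous_image continuous_intros) auto
  moreover have "continuous_on T sgn"
    using T by (intro continuous_intros) auto
  ultimately show ?thesis
    using continuous_closed_preimage[of T sgn "(\<lambda>y. sgn (y - x)) ` K"] T(1) by simp
qed

text \<open>Each point of the frontier of \<open>C \<inter> D\<close> lies on one of the two frontiers. Between the two
  rays both possibilities occur, so by connectedness some point lies on both.\<close>

lemma common_frontier_point_between_rays:
  fixes x :: "'a::euclidean_space"
  assumes C: "compact C" "convex C" and D: "compact D" "convex D"
    and x: "x \<in> interior C" "x \<in> interior D"
    and u: "x + u \<in> C - D" and v: "x + v \<in> D - C" and origin: "0 \<notin> closed_segment u v"
  obtains w d where "w \<in> open_segment u v" "0 < d" "x + d *\<^sub>R w \<in> frontier C \<inter> frontier D"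
proof -
  define E where "E = C \<inter> D"
  have E: "compact E" "closed E" "convex E" "x \<in> interior E"
    using C D x by (auto simp: E_def compact_Int compact_imp_closed convex_Int)
  define rays where
    "rays S = {w \<in> closed_segment u v. \<exists>d>0. x + d *\<^sub>R w \<in> frontier E \<inter> frontier S}" for S
  have closed: "closed (rays S)" for S
    unfolding rays_def using E origin
    by (intro closed_directions_hitting compact_Int_closed compact_frontier)
      (auto simp: frontier_def)
  have cover: "closed_segment u v \<subseteq> rays C \<union> rays D"
  proof
    fix w assume w: "w \<in> closed_segment u v"
    then obtain d where "0 < d" "x + d *\<^sub>R w \<in> frontier E"
      using ray_to_frontier[of E x w] E origin compact_imp_bounded by blast
    then show "w \<in> rays C \<union> rays D"
      using w frontier_Int_subset[of C D] by (auto simp: rays_def E_def)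
  qed
  have frontier_E: "y \<in> C \<inter> D" if "y \<in> frontier E" for y
    using that E(2) frontier_subset_closed unfolding E_def by blast
  have in_CD: "x \<in> C" "x \<in> D" using x interior_subset by auto
  have u_rays: "u \<notin> rays C"
    using ray_exit_interior[OF C(2) D(2) x(1) in_CD(2) u] frontier_E
    by (auto simp: rays_def frontier_def[of C])
  have v_rays: "v \<notin> rays D"
    using ray_exit_interior[OF D(2) C(2) x(2) in_CD(1) v] frontier_E
    by (auto simp: rays_def frontier_def[of D])
  have "rays C \<inter> closed_segment u v \<noteq> {}" "rays D \<inter> closed_segment u v \<noteq> {}"
    using cover u_rays v_rays ends_in_segment by blast+
  then obtain w where w: "w \<in> rays C" "w \<in> rays D"
    using connected_closedD[OF connected_segment _ cover closed closed] by blast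
  then obtain c d where "0 < c" "x + c *\<^sub>R w \<in> frontier E \<inter> frontier C"
      and "0 < d" "x + d *\<^sub>R w \<in> frontier E \<inter> frontier D"
    by (auto simp: rays_def)
  moreover from this have "c = d" using frontier_on_ray_unique[OF E(3,2,4)] by blast
  moreover have "w \<in> open_segment u v"
    using w u_rays v_rays by (auto simp: open_segment_def rays_def)
  ultimately show ?thesis using that by blast
qed

lemma common_frontier_point_in_quadrant:
  fixes x :: "'a::euclidean_space"
  assumes C: "compact C" "convex C" and D: "compact D" "convex D"
    and x: "x \<in> interior C" "x \<in> interior D"
    and indep: "\<And>s t. s *\<^sub>R u + t *\<^sub>R v = 0 \<Longrightarrow> s = 0 \<and> t = 0"
    and u: "x + k *\<^sub>R u \<in> C - D" and v: "x + l *\<^sub>R v \<in> D - C"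
  obtains \<alpha> \<beta> where "0 < \<alpha>" "0 < \<beta>"
    "x + (\<alpha> * k) *\<^sub>R u + (\<beta> * l) *\<^sub>R v \<in> frontier C \<inter> frontier D"
proof -
  have "k \<noteq> 0" "l \<noteq> 0" using u v x interior_subset[of C] interior_subset[of D] by auto
  have "0 \<notin> closed_segment (k *\<^sub>R u) (l *\<^sub>R v)"
  proof
    assume "0 \<in> closed_segment (k *\<^sub>R u) (l *\<^sub>R v)"
    then obtain s where "((1 - s) * k) *\<^sub>R u + (s * l) *\<^sub>R v = 0" by (auto simp: in_segment)
    then show False using indep \<open>k \<noteq> 0\<close> \<open>l \<noteq> 0\<close> by fastforce
  qed
  then obtain w d where w: "w \<in> open_segment (k *\<^sub>R u) (l *\<^sub>R v)" "0 < d"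
      "x + d *\<^sub>R w \<in> frontier C \<inter> frontier D"
    using common_frontier_point_between_rays[OF C D x u v] by blast
  then obtain s where s: "0 < s" "s < 1" "w = (1 - s) *\<^sub>R k *\<^sub>R u + s *\<^sub>R l *\<^sub>R v"
    by (auto simp: in_segment)
  show ?thesis
  proof (rule that)
    show "0 < d * (1 - s)" "0 < d * s" using w(2) s by simp_all
    have "x + (d * (1 - s) * k) *\<^sub>R u + (d * s * l) *\<^sub>R v = x + d *\<^sub>R w"
      by (simp add: s(3) scaleR_add_right mult.assoc)
    then show "x + (d * (1 - s) * k) *\<^sub>R u + (d * s * l) *\<^sub>R v \<in> frontier C \<inter> frontier D"
      using w(3) by (simp only:)
  qed
qed

lemma independent_if_rays_in_differences:
  fixes x :: "'a::real_vector"
  assumes "convex C" "convex D" "x \<in> C" "x \<in> D"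
    and "x + k *\<^sub>R u \<in> C - D" "x + k' *\<^sub>R u \<in> C - D" "x + l *\<^sub>R v \<in> D - C"
    and "k < 0" "0 < k'" "0 < l" and zero: "s *\<^sub>R u + t *\<^sub>R v = 0"
  shows "s = 0 \<and> t = 0"
proof (cases "t = 0")
  case True
  moreover have "u \<noteq> 0" using assms by auto
  ultimately show ?thesis using zero by simp
next
  case False
  define c where "c = 1 / t * - s"
  have "v = (1 / t) *\<^sub>R (t *\<^sub>R v)" using False by simp
  also have "t *\<^sub>R v = (- s) *\<^sub>R u" using zero by (simp add: add_eq_0_iff)
  finally have v: "v = c *\<^sub>R u" by (simp add: c_def)
  note no_ray = ray_not_in_both_differences[OF assms(1-4)]
  have False
  proof (cases "0 \<le> c")
    case True
    then show False using no_ray[of k' u "l * c"] assms v by simp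
  next
    case False
    then have "l * c \<le> 0" using assms by (simp add: mult_nonneg_nonpos)
    then show False using no_ray[of "- k" "- u" "- (l * c)"] assms v by simp
  qed
  then show ?thesis ..
qed

lemma four_common_frontier_points_in_quadrants:
  fixes x :: "'a::euclidean_space"
  assumes C: "compact C" "convex C" and D: "compact D" "convex D"
    and x: "x \<in> interior C" "x \<in> interior D"
    and indep: "\<And>s t. s *\<^sub>R u + t *\<^sub>R v = 0 \<Longrightarrow> s = 0 \<and> t = 0"
    and k: "k < 0" "0 < k'" "x + k *\<^sub>R u \<in> C - D" "x + k' *\<^sub>R u \<in> C - D"
    and l: "l < 0" "0 < l'" "x + l *\<^sub>R v \<in> D - C" "x + l' *\<^sub>R v \<in> D - C"
  shows "\<exists>Y\<subseteq>frontier C \<inter> frontier D. card Y = 4"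
proof -
  let ?K = "{k, k'} \<times> {l, l'}"
  have "\<forall>z\<in>?K. \<exists>y\<in>frontier C \<inter> frontier D. \<exists>\<alpha>>0. \<exists>\<beta>>0.
      y = x + (\<alpha> * fst z) *\<^sub>R u + (\<beta> * snd z) *\<^sub>R v"
  proof
    fix z assume "z \<in> ?K"
    then have "x + fst z *\<^sub>R u \<in> C - D" "x + snd z *\<^sub>R v \<in> D - C" using k l by auto
    then show "\<exists>y\<in>frontier C \<inter> frontier D. \<exists>\<alpha>>0. \<exists>\<beta>>0.
        y = x + (\<alpha> * fst z) *\<^sub>R u + (\<beta> * snd z) *\<^sub>R v"
      using common_frontier_point_in_quadrant[OF C D x indep] by metis
  qed
  then obtain y where y: "\<forall>z\<in>?K. y z \<in> frontier C \<inter> frontier D \<and> (\<exists>\<alpha>>0. \<exists>\<beta>>0.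
      y z = x + (\<alpha> * fst z) *\<^sub>R u + (\<beta> * snd z) *\<^sub>R v)"
    unfolding Bex_def by (rule bchoice[THEN exE])
  have "inj_on y ?K"
  proof (rule inj_onI)
    fix z z' assume z: "z \<in> ?K" "z' \<in> ?K" "y z = y z'"
    obtain \<alpha> \<beta> where \<alpha>\<beta>: "0 < \<alpha>" "0 < \<beta>" "y z = x + (\<alpha> * fst z) *\<^sub>R u + (\<beta> * snd z) *\<^sub>R v"
      using y z(1) by blast
    obtain \<alpha>' \<beta>' where \<alpha>\<beta>': "0 < \<alpha>'" "0 < \<beta>'"
        "y z' = x + (\<alpha>' * fst z') *\<^sub>R u + (\<beta>' * snd z') *\<^sub>R v"
      using y z(2) by blast
    have "(\<alpha> * fst z - \<alpha>' * fst z') *\<^sub>R u + (\<beta> * snd z - \<beta>' * snd z') *\<^sub>R v = 0"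
      using \<alpha>\<beta>(3) \<alpha>\<beta>'(3) z(3) by (simp add: algebra_simps)
    then have "sgn (\<alpha> * fst z) = sgn (\<alpha>' * fst z')" "sgn (\<beta> * snd z) = sgn (\<beta>' * snd z')"
      using indep by fastforce+
    then have "sgn (fst z) = sgn (fst z')" "sgn (snd z) = sgn (snd z')"
      using \<alpha>\<beta> \<alpha>\<beta>' by (simp_all add: sgn_mult)
    then show "z = z'" using z(1,2) k(1,2) l(1,2) by auto
  qed
  moreover have "card ?K = 4" using k l by simp
  ultimately have "card (y ` ?K) = 4" by (simp only: card_image)
  moreover have "y ` ?K \<subseteq> frontier C \<inter> frontier D" using y by blast
  ultimately show ?thesis by (intro exI[of _ "y ` ?K"]) simp
qed

lemma mem_open_segment_direction:
  fixes x :: "'a::real_vector"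
  assumes "x \<in> open_segment p q"
  obtains k l where "k < 0" "0 < l" "p = x + k *\<^sub>R (q - p)" "q = x + l *\<^sub>R (q - p)"
proof -
  obtain s where "0 < s" "s < 1" "x = (1 - s) *\<^sub>R p + s *\<^sub>R q"
    using assms by (auto simp: in_segment)
  then show ?thesis by (intro that[of "- s" "1 - s"]) (auto simp: algebra_simps)
qed

lemma four_common_frontier_points:
  fixes x :: "'a::euclidean_space"
  assumes C: "compact C" "convex C" and D: "compact D" "convex D"
    and x: "x \<in> interior C" "x \<in> interior D"
    and p: "p \<in> C - D" "p' \<in> C - D" "x \<in> open_segment p p'"
    and q: "q \<in> D - C" "q' \<in> D - C" "x \<in> open_segment q q'"
  shows "\<exists>Y\<subseteq>frontier C \<inter> frontier D. card Y = 4"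
proof -
  obtain k k' u where k: "k < 0" "0 < k'" "x + k *\<^sub>R u \<in> C - D" "x + k' *\<^sub>R u \<in> C - D"
    using mem_open_segment_direction[OF p(3)] p(1,2) by metis
  obtain l l' v where l: "l < 0" "0 < l'" "x + l *\<^sub>R v \<in> D - C" "x + l' *\<^sub>R v \<in> D - C"
    using mem_open_segment_direction[OF q(3)] q(1,2) by metis
  have "x \<in> C" "x \<in> D" using x interior_subset by auto
  then have "s = 0 \<and> t = 0" if "s *\<^sub>R u + t *\<^sub>R v = 0" for s t
    using independent_if_rays_in_differences[OF C(2) D(2) _ _ k(3,4) l(4) k(1,2) l(2) that] by blast
  then show ?thesis
    by (rule four_common_frontier_points_in_quadrants[OF C D x _ k l])
qed

lemma eventually_homothety_notin:
  fixes z :: "'a::real_normed_vector"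
  assumes "closed S" "z \<notin> S"
  shows "\<forall>\<^sub>F e in at_right 0. z - e *\<^sub>R (z - c) \<notin> S"
proof -
  have "((\<lambda>e. z - e *\<^sub>R (z - c)) \<longlongrightarrow> z - 0 *\<^sub>R (z - c)) (at_right 0)"
    by (intro tendsto_intros)
  then have "\<forall>\<^sub>F e in at_right 0. z - e *\<^sub>R (z - c) \<in> - S"
    using assms by (intro topological_tendstoD) (auto simp: open_Compl)
  then show ?thesis by simp
qed

lemma homothety_open_segment:
  fixes x :: "'a::real_vector"
  assumes "x \<in> open_segment p q" "e \<noteq> 1"
  shows "x - e *\<^sub>R (x - c) \<in> open_segment (p - e *\<^sub>R (p - c)) (q - e *\<^sub>R (q - c))"
proof -
  obtain s where s: "0 < s" "s < 1" "x = (1 - s) *\<^sub>R p + s *\<^sub>R q" "p \<noteq> q"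
    using assms by (auto simp: in_segment)
  have "p - e *\<^sub>R (p - c) \<noteq> q - e *\<^sub>R (q - c)"
  proof
    assume "p - e *\<^sub>R (p - c) = q - e *\<^sub>R (q - c)"
    then have "(1 - e) *\<^sub>R p = (1 - e) *\<^sub>R q" by (simp add: algebra_simps)
    then show False using s(4) assms(2) by simp
  qed
  moreover have "x - e *\<^sub>R (x - c) = (1 - s) *\<^sub>R (p - e *\<^sub>R (p - c)) + s *\<^sub>R (q - e *\<^sub>R (q - c))"
    unfolding s(3) by (simp add: algebra_simps)
  ultimately show ?thesis using s(1,2) unfolding in_segment by blast
qed

lemma four_common_frontier_points_if_segments_cross:
  fixes C D :: "'a::euclidean_space set"
  assumes C: "compact C" "convex C" and D: "compact D" "convex D"
    and "interior C \<inter> interior D \<noteq> {}"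
    and p: "p \<in> C - D" "p' \<in> C - D" and q: "q \<in> D - C" "q' \<in> D - C"
    and cross: "closed_segment p p' \<inter> closed_segment q q' \<noteq> {}"
  shows "\<exists>Y\<subseteq>frontier C \<inter> frontier D. card Y = 4"
proof -
  obtain c where centre: "c \<in> interior C" "c \<in> interior D" using assms(5) by blast
  obtain x where on_segments: "x \<in> closed_segment p p'" "x \<in> closed_segment q q'"
    using cross by blast
  then have in_CD: "x \<in> C" "x \<in> D" using p q C D closed_segment_subset by blast+
  then have x_open: "x \<in> open_segment p p'" "x \<in> open_segment q q'"
    using on_segments p q by (auto simp: open_segment_def)
  \<comment> \<open>A small homothety towards \<open>c\<close> moves the crossing point into both interiors.\<close>
  define H where "H e z = z - e *\<^sub>R (z - c)" for e z
  have "\<forall>\<^sub>F e in at_right (0::real). e \<in> {0<..<1}"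
    by (intro eventually_at_right_real) auto
  then have "\<forall>\<^sub>F e in at_right 0. e \<in> {0<..<1} \<and>
      H e p \<notin> D \<and> H e p' \<notin> D \<and> H e q \<notin> C \<and> H e q' \<notin> C"
    unfolding H_def using p q C D
    by (intro eventually_conj eventually_homothety_notin compact_imp_closed) auto
  then obtain e where e: "e \<in> {0<..<1}" "H e p \<notin> D" "H e p' \<notin> D" "H e q \<notin> C" "H e q' \<notin> C"
    using eventually_happens'[OF trivial_limit_at_right_real] by (metis (no_types, lifting))
  have shrink: "H e z \<in> interior S" if "convex S" "c \<in> interior S" "z \<in> S" for S z
    unfolding H_def using mem_interior_convex_shrink[OF that] e(1) by simp
  have "H e p \<in> C" "H e p' \<in> C" "H e q \<in> D" "H e q' \<in> D"
    using shrink C D centre p q interior_subset by (meson DiffD1 subsetD)+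
  moreover have "H e x \<in> interior C" "H e x \<in> interior D" using shrink C D centre in_CD by auto
  moreover have "H e x \<in> open_segment (H e p) (H e p')" "H e x \<in> open_segment (H e q) (H e q')"
    unfolding H_def using x_open e(1) by (auto intro: homothety_open_segment)
  ultimately show ?thesis using four_common_frontier_points[OF C D] e by blast
qed

section \<open>Alternating directions\<close>

definition dir :: "real \<Rightarrow> plane" where
  "dir \<theta> = vector [cos \<theta>, sin \<theta>]"

lemma inner_dir: "dir \<theta> \<bullet> x = cos \<theta> * x $ 1 + sin \<theta> * x $ 2"
  by (simp add: dir_def inner_vec_def sum_2)

lemma dir_nonzero [simp]: "dir \<theta> \<noteq> 0"
  using sin_zero_abs_cos_one[of \<theta>] by (auto simp: dir_def vec_eq_iff forall_2)

lemma dir_add_2pi [simp]: "dir (\<theta> + 2 * pi) = dir \<theta>"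
  by (simp add: dir_def)

lemma dir_add_pi: "dir (\<theta> + pi) = - dir \<theta>"
  by (simp add: dir_def vec_eq_iff forall_2)

lemma continuous_on_dir: "continuous_on S dir"
proof -
  have dir_eq: "dir = (\<lambda>\<theta>. cos \<theta> *\<^sub>R axis 1 1 + sin \<theta> *\<^sub>R axis 2 1)"
    by (auto simp: dir_def vec_eq_iff forall_2 axis_def)
  show ?thesis unfolding dir_eq by (intro continuous_intros)
qed

lemma polar_decomposition:
  fixes x :: plane
  assumes "x \<noteq> 0"
  obtains r \<phi> where "0 < r" "\<theta> < \<phi>" "\<phi> \<le> \<theta> + 2 * pi" "x = r *\<^sub>R dir \<phi>"
proof -
  define z where "z = cis (- (\<theta> + pi)) * Complex (x $ 1) (x $ 2)"
  define \<phi> where "\<phi> = \<theta> + pi + Arg z"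
  have "Complex (x $ 1) (x $ 2) = cis (\<theta> + pi) * z"
    by (simp add: z_def mult.assoc[symmetric] cis_mult)
  also have "\<dots> = cis (\<theta> + pi) * rcis (cmod z) (Arg z)" by (simp add: rcis_cmod_Arg)
  also have "\<dots> = rcis (cmod z) \<phi>"
    by (simp add: rcis_def \<phi>_def mult.left_commute cis_mult)
  finally have x: "x = cmod z *\<^sub>R dir \<phi>"
    by (simp add: complex_eq_iff dir_def vec_eq_iff forall_2)
  then have "0 < cmod z" using assms by auto
  then show ?thesis
    by (rule that[OF _ _ _ x]) (use Arg_bounded[of z] in \<open>auto simp: \<phi>_def\<close>)
qed

lemma inner_dir_pos_between:
  assumes "a < b" "b < c" "c < a + pi" "0 \<le> dir a \<bullet> x" "0 \<le> dir c \<bullet> x"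
    and "0 < dir a \<bullet> x \<or> 0 < dir c \<bullet> x"
  shows "0 < dir b \<bullet> x"
proof -
  have "0 < sin (c - b)" "0 < sin (b - a)" "0 < sin (c - a)"
    using assms by (auto intro: sin_gt_zero)
  then have "0 < sin (c - b) * (dir a \<bullet> x) + sin (b - a) * (dir c \<bullet> x)"
    using assms(4-) by (auto intro: add_pos_nonneg add_nonneg_pos)
  also have "\<dots> = sin (c - a) * (dir b \<bullet> x)"
    by (simp add: inner_dir sin_diff algebra_simps)
  finally show ?thesis using \<open>0 < sin (c - a)\<close> by (simp add: zero_less_mult_iff)
qed

text \<open>If \<open>dir \<phi>\<close> separates \<open>P\<close> from \<open>Q\<close>, then turning from \<open>\<phi>\<close> through a full circle the
  maximizer switches from \<open>P\<close> to \<open>Q\<close> once and back once.\<close>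

lemma separated_maximizers_not_alternating:
  assumes sep: "\<And>p q. \<lbrakk>p \<in> P; q \<in> Q\<rbrakk> \<Longrightarrow> 0 < dir \<phi> \<bullet> (p - q)"
    and t: "\<phi> \<le> t" "t < t'" "t' < t''" "t'' < \<phi> + 2 * pi"
    and q: "q \<in> Q" "\<And>p. p \<in> P \<Longrightarrow> dir t \<bullet> p \<le> dir t \<bullet> q"
    and p: "p \<in> P" "\<And>q. q \<in> Q \<Longrightarrow> dir t' \<bullet> q \<le> dir t' \<bullet> p"
    and q': "q' \<in> Q" "\<And>p. p \<in> P \<Longrightarrow> dir t'' \<bullet> p \<le> dir t'' \<bullet> q'"
  shows False
proof -
  have signs: "dir t \<bullet> (p - q) \<le> 0" "0 \<le> dir t' \<bullet> (p - q)" "0 < dir \<phi> \<bullet> (p - q)"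
      "dir t'' \<bullet> (p - q') \<le> 0" "0 \<le> dir t' \<bullet> (p - q')" "0 < dir (\<phi> + 2 * pi) \<bullet> (p - q')"
    using sep q p q' by (auto simp: inner_diff_right)
  then have "\<phi> \<noteq> t" by auto
  consider (first_half) "t' < \<phi> + pi" | (opposite) "t' = \<phi> + pi" | (second_half) "\<phi> + pi < t'"
    by linarith
  then show False
  proof cases
    case first_half
    then show False using inner_dir_pos_between[of \<phi> t t' "p - q"] t signs \<open>\<phi> \<noteq> t\<close> by simp
  next
    case opposite
    then show False using signs by (simp add: dir_add_pi)
  next
    case second_half
    then show False using inner_dir_pos_between[of t' t'' "\<phi> + 2 * pi" "p - q'"] t signs by simp
  qed
qed

lemma alternating_maximizers_cross:
  assumes \<theta>: "\<theta>1 < \<theta>2" "\<theta>2 < \<theta>3" "\<theta>3 < \<theta>4" "\<theta>4 < \<theta>1 + 2 * pi"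
    and p: "\<And>y. y \<in> {q, q'} \<Longrightarrow> dir \<theta>1 \<bullet> y \<le> dir \<theta>1 \<bullet> p"
    and q: "\<And>y. y \<in> {p, p'} \<Longrightarrow> dir \<theta>2 \<bullet> y \<le> dir \<theta>2 \<bullet> q"
    and p': "\<And>y. y \<in> {q, q'} \<Longrightarrow> dir \<theta>3 \<bullet> y \<le> dir \<theta>3 \<bullet> p'"
    and q': "\<And>y. y \<in> {p, p'} \<Longrightarrow> dir \<theta>4 \<bullet> y \<le> dir \<theta>4 \<bullet> q'"
  shows "closed_segment p p' \<inter> closed_segment q q' \<noteq> {}"
proof
  assume "closed_segment p p' \<inter> closed_segment q q' = {}"
  then obtain x b where x: "\<forall>y\<in>closed_segment q q'. x \<bullet> y < b" "\<forall>y\<in>closed_segment p p'. b < x \<bullet> y"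
    using separating_hyperplane_compact_closed[of "closed_segment q q'" "closed_segment p p'"]
    by (auto intro: compact_imp_closed)
  then have "x \<noteq> 0" by (metis ends_in_segment(1) inner_zero_left order.asym)
  then obtain r \<phi> where \<phi>: "0 < r" "\<theta>4 - 2 * pi < \<phi>" "\<phi> \<le> \<theta>4" "x = r *\<^sub>R dir \<phi>"
    using polar_decomposition[of x "\<theta>4 - 2 * pi"] by auto
  have sep: "0 < dir \<phi> \<bullet> (y - z)" if "y \<in> {p, p'}" "z \<in> {q, q'}" for y z
  proof -
    have "0 < x \<bullet> (y - z)" using x that by (force simp: inner_diff_right)
    then show ?thesis using \<phi> by (simp add: zero_less_mult_iff)
  qed
  note contra = separated_maximizers_not_alternating[of "{p, p'}" "{q, q'}", OF sep]
  show False
  proof (cases "\<phi> \<le> \<theta>2")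
    case True
    then show False
      by (intro contra[of \<theta>2 \<theta>3 \<theta>4 q p' q']) (use \<theta> \<phi> q p' q' in auto)
  next
    case False
    then have "\<phi> \<le> \<theta>4" "\<theta>2 < \<phi>" using \<phi> by auto
    then show False
      by (intro contra[of \<theta>4 "\<theta>1 + 2 * pi" "\<theta>2 + 2 * pi" q' p q]) (use \<theta> q' p q in auto)
  qed
qed

section \<open>Support functions\<close>

definition support_fun :: "'a::real_inner set \<Rightarrow> 'a \<Rightarrow> real" where
  "support_fun K a = (SUP x\<in>K. a \<bullet> x)"

lemma support_fun_ge:
  assumes "compact K" "x \<in> K"
  shows "a \<bullet> x \<le> support_fun K a"
proof -
  have "compact ((\<bullet>) a ` K)" using assms by (intro compact_continuous_image continuous_intros)
  then show ?thesis
    unfolding support_fun_def using assms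
    by (intro cSUP_upper bounded_imp_bdd_above compact_imp_bounded) auto
qed

lemma support_fun_attained:
  assumes "compact K" "K \<noteq> {}"
  obtains x where "x \<in> K" "a \<bullet> x = support_fun K a"
proof -
  have "continuous_on K ((\<bullet>) a)" by (intro continuous_intros)
  then obtain x where x: "x \<in> K" "\<forall>y\<in>K. a \<bullet> y \<le> a \<bullet> x"
    using continuous_attains_sup[OF assms] by blast
  then have "support_fun K a = a \<bullet> x"
    unfolding support_fun_def by (intro cSup_eq_maximum) auto
  then show ?thesis using that x by simp
qed

lemma support_fun_scaleR:
  assumes "compact K" "K \<noteq> {}" "0 \<le> r"
  shows "support_fun K (r *\<^sub>R a) = r * support_fun K a"
proof (rule antisym)
  obtain x where "x \<in> K" "r *\<^sub>R a \<bullet> x = support_fun K (r *\<^sub>R a)"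
    using support_fun_attained assms by blast
  then show "support_fun K (r *\<^sub>R a) \<le> r * support_fun K a"
    using support_fun_ge[of K x a] assms by (metis inner_scaleR_left mult_left_mono)
  obtain y where "y \<in> K" "a \<bullet> y = support_fun K a"
    using support_fun_attained assms by blast
  then show "r * support_fun K a \<le> support_fun K (r *\<^sub>R a)"
    using support_fun_ge[of K y "r *\<^sub>R a"] assms by simp
qed

lemma continuous_on_support_fun:
  assumes "compact K" "K \<noteq> {}"
  shows "continuous_on S (support_fun K)"
proof -
  obtain M where M: "0 < M" "\<And>x. x \<in> K \<Longrightarrow> norm x \<le> M"
    using compact_imp_bounded[OF assms(1)] by (auto simp: bounded_pos)
  have diff: "support_fun K a - support_fun K b \<le> M * dist a b" for a b
  proof -
    obtain x where x: "x \<in> K" "a \<bullet> x = support_fun K a" using support_fun_attained[OF assms] .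
    have "support_fun K a - support_fun K b \<le> (a - b) \<bullet> x"
      using support_fun_ge[OF assms(1) x(1), of b] x(2) by (simp add: inner_diff_left)
    also have "\<dots> \<le> norm (a - b) * norm x" by (rule norm_cauchy_schwarz)
    also have "\<dots> \<le> M * dist a b"
      using M(2)[OF x(1)] by (simp add: dist_norm mult.commute[of M] mult_left_mono)
    finally show ?thesis .
  qed
  have "dist (support_fun K a) (support_fun K b) \<le> M * dist a b" for a b
    using diff[of a b] diff[of b a] by (simp add: dist_real_def abs_le_iff dist_commute)
  then have "M-lipschitz_on S (support_fun K)" using M(1) by (intro lipschitz_onI) auto
  then show ?thesis by (rule lipschitz_on_continuous_on)
qed

abbreviation supp :: "plane set \<Rightarrow> real \<Rightarrow> real" where
  "supp K \<theta> \<equiv> support_fun K (dir \<theta>)"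

lemma continuous_on_supp:
  assumes "compact K" "K \<noteq> {}"
  shows "continuous_on S (supp K)"
  using continuous_on_compose2[OF continuous_on_support_fun[OF assms] continuous_on_dir] by blast

lemma support_fun_less_if_not_subset_hull:
  fixes C :: "'a::euclidean_space set"
  assumes C: "compact C" and F: "finite F" "\<And>D. D \<in> F \<Longrightarrow> compact D \<and> D \<noteq> {}"
    and "\<not> C \<subseteq> convex hull (\<Union>F)"
  obtains a where "\<And>D. D \<in> F \<Longrightarrow> support_fun D a < support_fun C a"
proof -
  obtain x where x: "x \<in> C" "x \<notin> convex hull (\<Union>F)" using assms(4) by blast
  have "compact (convex hull (\<Union>F))" using F by (auto intro: compact_convex_hull compact_Union)
  then obtain a b where hyperplane: "a \<bullet> x < b" "\<forall>y\<in>convex hull (\<Union>F). b < a \<bullet> y"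
    using separating_hyperplane_closed_point[OF convex_convex_hull _ x(2)] compact_imp_closed
    by blast
  show ?thesis
  proof (rule that)
    fix D assume D: "D \<in> F"
    then obtain y where y: "y \<in> D" "(- a) \<bullet> y = support_fun D (- a)"
      using support_fun_attained F(2) by blast
    then have "b < a \<bullet> y" using hyperplane(2) D hull_subset[of "\<Union>F" convex] by blast
    then show "support_fun D (- a) < support_fun C (- a)"
      using y(2) hyperplane(1) support_fun_ge[OF C x(1), of "- a"] by simp
  qed
qed

lemma on_upper_envelope_if_not_subset_hull:
  assumes F: "finite F" "\<And>D. D \<in> F \<Longrightarrow> compact D \<and> D \<noteq> {}" and C: "C \<in> F"
    and outside: "\<not> C \<subseteq> convex hull (\<Union>(F - {C}))"
  shows "on_upper_envelope supp {\<theta>..\<theta> + 2 * pi} F C"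
proof -
  obtain a where a: "\<And>D. D \<in> F - {C} \<Longrightarrow> support_fun D a < support_fun C a"
    by (rule support_fun_less_if_not_subset_hull[OF _ _ _ outside]) (use F C in auto)
  show ?thesis
  proof (cases "a = 0")
    case True
    have "support_fun D 0 = 0" if "D \<in> F" for D
      using support_fun_scaleR[of D 0 0] F(2)[OF that] by simp
    then have no_others: "F - {C} = {}" using a C True by fastforce
    show ?thesis
      unfolding on_upper_envelope_def no_others by (intro bexI[of _ \<theta>]) simp_all
  next
    case False
    then obtain r t where t: "0 < r" "\<theta> < t" "t \<le> \<theta> + 2 * pi" "a = r *\<^sub>R dir t"
      by (rule polar_decomposition)
    have "supp D t < supp C t" if D: "D \<in> F - {C}" for D
      using a[OF D] F D C t(1) by (simp add: t(4) support_fun_scaleR)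
    then show ?thesis
      unfolding on_upper_envelope_def using t(2,3) by (intro bexI[of _ t] ballI) auto
  qed
qed

lemma not_subset_hull_if_on_upper_envelope:
  assumes F: "\<And>D. D \<in> F \<Longrightarrow> compact D \<and> D \<noteq> {}" and C: "C \<in> F"
    and envelope: "on_upper_envelope supp T F C"
  shows "\<not> C \<subseteq> convex hull (\<Union>(F - {C}))"
proof -
  obtain t where t: "\<And>D. D \<in> F - {C} \<Longrightarrow> supp D t < supp C t"
    using envelope by (auto simp: on_upper_envelope_def)
  have "\<Union>(F - {C}) \<subseteq> {y. dir t \<bullet> y < supp C t}"
    using t F support_fun_ge by (fastforce intro: le_less_trans)
  then have "convex hull (\<Union>(F - {C})) \<subseteq> {y. dir t \<bullet> y < supp C t}"
    by (intro hull_minimal convex_halfspace_lt)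
  moreover obtain x where "x \<in> C" "dir t \<bullet> x = supp C t"
    using support_fun_attained F C by metis
  ultimately show ?thesis by fastforce
qed

lemma convex_position_iff_on_upper_envelope:
  assumes "finite F" "\<And>C. C \<in> F \<Longrightarrow> compact C \<and> C \<noteq> {}"
  shows "convex_position F \<longleftrightarrow> (\<forall>C\<in>F. on_upper_envelope supp {\<theta>..\<theta> + 2 * pi} F C)"
  unfolding convex_position_def
proof (intro ball_cong refl iffI)
  fix C assume C: "C \<in> F"
  show "on_upper_envelope supp {\<theta>..\<theta> + 2 * pi} F C"
    if "\<not> C \<subseteq> convex hull (\<Union>(F - {C}))"
    using assms C that by (rule on_upper_envelope_if_not_subset_hull)
  show "\<not> C \<subseteq> convex hull (\<Union>(F - {C}))"
    if "on_upper_envelope supp {\<theta>..\<theta> + 2 * pi} F C"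
    using assms(2) C that by (rule not_subset_hull_if_on_upper_envelope)
qed

section \<open>Common tangents\<close>

definition common_tangent_at_intersection :: "plane set \<Rightarrow> plane set \<Rightarrow> bool" where
  "common_tangent_at_intersection C D \<longleftrightarrow>
     (\<exists>L. tangent_line L C \<and> tangent_line L D \<and> L \<inter> (C \<inter> D) \<noteq> {})"

lemma common_tangent_at_intersection_commute:
  "common_tangent_at_intersection C D \<longleftrightarrow> common_tangent_at_intersection D C"
  unfolding common_tangent_at_intersection_def by (metis Int_commute)

lemma tangent_line_support_fun:
  assumes "compact C" "C \<noteq> {}" "a \<noteq> 0"
  shows "tangent_line {x. a \<bullet> x = support_fun C a} C"
  unfolding tangent_line_def
proof (intro exI conjI)
  show "{x. a \<bullet> x = support_fun C a} \<inter> C \<noteq> {}" using support_fun_attained assms(1,2) by blast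
  show "\<forall>x\<in>C. a \<bullet> x \<le> support_fun C a" using support_fun_ge assms(1) by blast
qed (use assms(3) in auto)

lemma support_point_outside:
  assumes "compact C" "C \<noteq> {}" "compact D" "D \<noteq> {}" "a \<noteq> 0"
    and support_le: "support_fun D a \<le> support_fun C a"
    and no_tangent: "\<not> common_tangent_at_intersection C D"
  obtains p where "p \<in> C - D" "a \<bullet> p = support_fun C a"
proof -
  obtain p where p: "p \<in> C" "a \<bullet> p = support_fun C a" using support_fun_attained assms(1,2) .
  have "p \<notin> D"
  proof
    assume "p \<in> D"
    then have "support_fun D a = support_fun C a"
      using support_fun_ge[of D p a] assms(3) support_le p(2) by simp
    then have "tangent_line {x. a \<bullet> x = support_fun C a} C"
        "tangent_line {x. a \<bullet> x = support_fun C a} D"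
      using tangent_line_support_fun[of C a] tangent_line_support_fun[of D a] assms by simp_all
    then show False
      using no_tangent p \<open>p \<in> D\<close> unfolding common_tangent_at_intersection_def by blast
  qed
  then show ?thesis using that p by blast
qed

lemma common_tangent_if_interiors_disjoint:
  assumes C: "convex_body C" and D: "convex_body D"
    and x: "x \<in> C \<inter> D" and disjoint: "interior C \<inter> interior D = {}"
  shows "common_tangent_at_intersection C D"
proof -
  have bodies: "closed C" "convex C" "interior C \<noteq> {}" "closed D" "convex D" "interior D \<noteq> {}"
    using C D by (auto simp: convex_body_def compact_imp_closed)
  obtain a b where hyperplane: "a \<noteq> 0" "\<forall>y\<in>interior C. a \<bullet> y \<le> b" "\<forall>y\<in>interior D. b \<le> a \<bullet> y"
    using separating_hyperplane_sets[of "interior C" "interior D"] bodies disjoint convex_interior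
    by blast
  have "closure (interior C) \<subseteq> {y. a \<bullet> y \<le> b}"
    using hyperplane(2) by (intro closure_minimal closed_halfspace_le) auto
  moreover have "closure (interior D) \<subseteq> {y. b \<le> a \<bullet> y}"
    using hyperplane(3) by (intro closure_minimal closed_halfspace_ge) auto
  ultimately have sides: "\<forall>y\<in>C. a \<bullet> y \<le> b" "\<forall>y\<in>D. b \<le> a \<bullet> y"
    using bodies by (auto simp: convex_closure_interior)
  then have on_line: "a \<bullet> x = b" using x by force
  have "tangent_line {y. a \<bullet> y = b} C"
    unfolding tangent_line_def using hyperplane(1) sides(1) on_line x by blast
  moreover have "tangent_line {y. a \<bullet> y = b} D"
    unfolding tangent_line_def
    by (rule exI[of _ "- a"], rule exI[of _ "- b"]) (use hyperplane(1) sides(2) on_line x in auto)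
  ultimately show ?thesis
    using on_line x unfolding common_tangent_at_intersection_def by blast
qed

section \<open>Alternating differences of support functions\<close>

definition alternates :: "real \<Rightarrow> (real \<Rightarrow> real) \<Rightarrow> bool" where
  "alternates p g \<longleftrightarrow> (\<exists>t1 t2 t3 t4. t1 < t2 \<and> t2 < t3 \<and> t3 < t4 \<and> t4 < t1 + p \<and>
     0 \<le> g t1 \<and> g t2 \<le> 0 \<and> 0 \<le> g t3 \<and> g t4 \<le> 0)"

lemma finite_zeros_if_not_alternates:
  assumes "\<not> alternates p g"
  shows "finite {t \<in> {s..<s + p}. g t = 0}" (is "finite ?Z")
proof (rule ccontr)
  assume "infinite ?Z"
  then obtain T where T: "finite T" "card T = 4" "T \<subseteq> ?Z"
    using infinite_arbitrarily_large by blast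
  define xs where "xs = sorted_list_of_set T"
  have xs: "length xs = 4" "sorted_wrt (<) xs" "set xs = T"
    using T by (auto simp: xs_def)
  have less: "xs ! i < xs ! j" if "i < j" "j < 4" for i j
    using sorted_wrt_nth_less[OF xs(2) that(1)] xs(1) that by simp
  have mem: "xs ! i \<in> ?Z" if "i < 4" for i using nth_mem[of i xs] xs T that by auto
  have "alternates p g"
    unfolding alternates_def
    by (intro exI[of _ "xs ! 0"] exI[of _ "xs ! 1"] exI[of _ "xs ! 2"] exI[of _ "xs ! 3"])
      (use less[of 0 1] less[of 1 2] less[of 2 3] mem[of 0] mem[of 1] mem[of 2] mem[of 3] in auto)
  then show False using assms by blast
qed

lemma nonneg_set_interval:
  fixes g :: "real \<Rightarrow> real"
  assumes cont: "continuous_on {u..v} g" and ends: "g u < 0" "g v < 0"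
    and t0: "t0 \<in> {u..v}" "0 < g t0"
  obtains a b where "u < a" "a < t0" "t0 < b" "b < v" "g a = 0" "g b = 0"
    "\<And>t. \<lbrakk>t \<in> {u..v}; t < a \<or> b < t\<rbrakk> \<Longrightarrow> g t < 0"
proof -
  define S where "S = {t \<in> {u..v}. 0 \<le> g t}"
  have "closed S"
    unfolding S_def using cont by (intro continuous_on_closed_Collect_le continuous_on_const) auto
  moreover have "S \<noteq> {}" using t0 by (auto simp: S_def)
  moreover have "bdd_below S" "bdd_above S"
    by (auto simp: S_def intro!: bdd_belowI[of _ u] bdd_aboveI[of _ v])
  ultimately have S: "S \<noteq> {}" "closed S" "bdd_below S" "bdd_above S" by simp_all
  define a where "a = Inf S"
  define b where "b = Sup S"
  have "a \<in> S" "b \<in> S"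
    using S by (auto simp: a_def b_def closed_contains_Inf closed_contains_Sup)
  then have endpoints: "u \<le> a" "a \<le> v" "0 \<le> g a" "u \<le> b" "b \<le> v" "0 \<le> g b" by (auto simp: S_def)
  have outside: "g t < 0" if "t \<in> {u..v}" "t < a \<or> b < t" for t
  proof (rule ccontr)
    assume "\<not> g t < 0"
    then have "t \<in> S" using that by (simp add: S_def)
    then have "a \<le> t" "t \<le> b" using S by (auto simp: a_def b_def cInf_lower cSup_upper)
    then show False using that by auto
  qed
  obtain t where "u \<le> t" "t \<le> a" "g t = 0"
    using IVT'[of g u 0 a] ends endpoints continuous_on_subset[OF cont, of "{u..a}"] by auto
  then have "g a = 0" using outside[of t] endpoints by (cases "t = a") auto
  moreover obtain t where "b \<le> t" "t \<le> v" "g t = 0"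
    using IVT2'[of g v 0 b] ends endpoints continuous_on_subset[OF cont, of "{b..v}"] by auto
  then have "g b = 0" using outside[of t] endpoints by (cases "t = b") auto
  moreover have "a \<noteq> u" "b \<noteq> v" "a \<le> t0" "t0 \<le> b" "a \<noteq> t0" "b \<noteq> t0"
    using calculation ends t0 outside[of t0] by force+
  ultimately show ?thesis using endpoints outside by (intro that[of a b]) auto
qed

lemma overtakes_between_if_not_alternates:
  assumes "continuous_on {s..s + p} f" "continuous_on {s..s + p} g"
    and not_alternates: "\<not> alternates p (\<lambda>t. g t - f t)"
    and ends: "g s < f s" "g (s + p) < f (s + p)"
    and t0: "t0 \<in> {s..s + p}" "f t0 < g t0"
  obtains a b where "overtakes_between s (s + p) a b f g"
proof -
  have "continuous_on {s..s + p} (\<lambda>t. g t - f t)" using assms(1,2) by (intro continuous_intros)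
  then obtain a b where endpoints: "s < a" "a < t0" "t0 < b" "b < s + p"
      "g a - f a = 0" "g b - f b = 0"
    and outside: "\<And>t. \<lbrakk>t \<in> {s..s + p}; t < a \<or> b < t\<rbrakk> \<Longrightarrow> g t - f t < 0"
    by (rule nonneg_set_interval[of s "s + p" "\<lambda>t. g t - f t" t0]) (use ends t0 in auto)
  have inside: "0 < g t - f t" if "a < t" "t < b" for t
  proof (rule ccontr)
    assume "\<not> 0 < g t - f t"
    then have "alternates p (\<lambda>t. g t - f t)"
      unfolding alternates_def
      by (intro exI[of _ a] exI[of _ t] exI[of _ b] exI[of _ "s + p"])
        (use that endpoints ends in auto)
    then show False using not_alternates by blast
  qed
  have "overtakes_between s (s + p) a b f g"
    unfolding overtakes_between_def
  proof (intro conjI ballI)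
    fix t assume t: "t \<in> {s..s + p}"
    consider "t < a \<or> b < t" | "t = a \<or> t = b" | "a < t" "t < b" by linarith
    then show "f t < g t \<longleftrightarrow> a < t \<and> t < b" "g t < f t \<longleftrightarrow> t < a \<or> b < t"
      using outside[OF t] inside[of t] endpoints by (cases; force)+
  qed (use endpoints in auto)
  then show ?thesis by (rule that)
qed

lemma alternating_supports_crossing_segments:
  assumes C: "compact C" "C \<noteq> {}" and D: "compact D" "D \<noteq> {}"
    and no_tangent: "\<not> common_tangent_at_intersection C D"
    and alternates: "alternates (2 * pi) (\<lambda>\<theta>. supp C \<theta> - supp D \<theta>)"
  obtains p p' q q' where "p \<in> C - D" "p' \<in> C - D" "q \<in> D - C" "q' \<in> D - C"
    "closed_segment p p' \<inter> closed_segment q q' \<noteq> {}"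
proof -
  obtain \<theta>1 \<theta>2 \<theta>3 \<theta>4 where \<theta>: "\<theta>1 < \<theta>2" "\<theta>2 < \<theta>3" "\<theta>3 < \<theta>4" "\<theta>4 < \<theta>1 + 2 * pi"
    and order: "supp D \<theta>1 \<le> supp C \<theta>1" "supp C \<theta>2 \<le> supp D \<theta>2"
      "supp D \<theta>3 \<le> supp C \<theta>3" "supp C \<theta>4 \<le> supp D \<theta>4"
    using alternates by (auto simp: alternates_def)
  have no_tangent': "\<not> common_tangent_at_intersection D C"
    using no_tangent common_tangent_at_intersection_commute by blast
  note in_C = support_point_outside[OF C D dir_nonzero _ no_tangent]
  note in_D = support_point_outside[OF D C dir_nonzero _ no_tangent']
  obtain p where p: "p \<in> C - D" "dir \<theta>1 \<bullet> p = supp C \<theta>1" by (rule in_C[OF order(1)])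
  obtain q where q: "q \<in> D - C" "dir \<theta>2 \<bullet> q = supp D \<theta>2" by (rule in_D[OF order(2)])
  obtain p' where p': "p' \<in> C - D" "dir \<theta>3 \<bullet> p' = supp C \<theta>3" by (rule in_C[OF order(3)])
  obtain q' where q': "q' \<in> D - C" "dir \<theta>4 \<bullet> q' = supp D \<theta>4" by (rule in_D[OF order(4)])
  have "dir \<theta>1 \<bullet> y \<le> dir \<theta>1 \<bullet> p" "dir \<theta>3 \<bullet> y \<le> dir \<theta>3 \<bullet> p'" if "y \<in> {q, q'}" for y
    using support_fun_ge[OF D(1), of y] that q q' p p' order by (auto intro: order_trans)
  moreover have "dir \<theta>2 \<bullet> y \<le> dir \<theta>2 \<bullet> q" "dir \<theta>4 \<bullet> y \<le> dir \<theta>4 \<bullet> q'" if "y \<in> {p, p'}" for y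
    using support_fun_ge[OF C(1), of y] that q q' p p' order by (auto intro: order_trans)
  ultimately have "closed_segment p p' \<inter> closed_segment q q' \<noteq> {}"
    by (intro alternating_maximizers_cross[OF \<theta>])
  then show ?thesis by (rule that[OF p(1) p'(1) q(1) q'(1)])
qed

lemma not_alternates_supp:
  assumes C: "convex_body C" and D: "convex_body D"
    and frontiers: "finite (frontier C \<inter> frontier D)" "card (frontier C \<inter> frontier D) \<le> 2"
    and no_tangent: "\<not> common_tangent_at_intersection C D"
  shows "\<not> alternates (2 * pi) (\<lambda>\<theta>. supp C \<theta> - supp D \<theta>)"
proof
  assume alternates: "alternates (2 * pi) (\<lambda>\<theta>. supp C \<theta> - supp D \<theta>)"
  have bodies: "compact C" "convex C" "C \<noteq> {}" "compact D" "convex D" "D \<noteq> {}"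
    using C D by (auto simp: convex_body_def)
  obtain p p' q q' where points: "p \<in> C - D" "p' \<in> C - D" "q \<in> D - C" "q' \<in> D - C"
    and cross: "closed_segment p p' \<inter> closed_segment q q' \<noteq> {}"
    by (rule alternating_supports_crossing_segments[OF bodies(1,3,4,6) no_tangent alternates])
  have "closed_segment p p' \<subseteq> C" "closed_segment q q' \<subseteq> D"
    using points bodies by (simp_all add: closed_segment_subset)
  then have "C \<inter> D \<noteq> {}" using cross by blast
  then have "interior C \<inter> interior D \<noteq> {}"
    using common_tangent_if_interiors_disjoint[OF C D] no_tangent by blast
  then obtain Y where "Y \<subseteq> frontier C \<inter> frontier D" "card Y = 4"
    using four_common_frontier_points_if_segments_cross[OF bodies(1,2,4,5) _ points cross] by blast
  then show False using frontiers(2) card_mono[OF frontiers(1), of Y] by simp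
qed

section \<open>Families of bodies\<close>

lemma decreasing_enumeration:
  fixes g :: "'a \<Rightarrow> 'b::linorder"
  assumes "finite F" "inj_on g F"
  obtains B where "bij_betw B {1..card F} F"
    "\<And>i j. \<lbrakk>i \<in> {1..card F}; j \<in> {1..card F}; i < j\<rbrakk> \<Longrightarrow> g (B j) < g (B i)"
proof -
  define xs where "xs = rev (sorted_list_of_set (g ` F))"
  have xs: "length xs = card F" "sorted_wrt (>) xs" "set xs = g ` F"
    using assms by (auto simp: xs_def card_image sorted_wrt_rev)
  define B where "B i = inv_into F g (xs ! (i - 1))" for i
  have B: "g (B i) = xs ! (i - 1)" "B i \<in> F" if "i \<in> {1..card F}" for i
    using nth_mem[of "i - 1" xs] xs that by (auto simp: B_def f_inv_into_f inv_into_into)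
  have dec: "g (B j) < g (B i)" if "i \<in> {1..card F}" "j \<in> {1..card F}" "i < j" for i j
    using sorted_wrt_nth_less[OF xs(2), of "i - 1" "j - 1"] B xs that by auto
  have inj: "inj_on B {1..card F}"
    by (rule linorder_inj_onI) (use dec in fastforce)+
  then have "B ` {1..card F} = F"
    using B assms by (intro card_subset_eq) (auto simp: card_image)
  then show ?thesis using that[of B] dec inj by (simp add: bij_betw_def)
qed

locale body_family =
  fixes F :: "plane set set"
  assumes finite: "finite F"
    and body: "C \<in> F \<Longrightarrow> convex_body C"
    and noncrossing: "noncrossing F"
    and general_position: "general_position F"
begin

lemma compact: "C \<in> F \<Longrightarrow> compact C" and nonempty: "C \<in> F \<Longrightarrow> C \<noteq> {}"
  using body[of C] interior_empty by (auto simp: convex_body_def)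

lemma not_alternates:
  assumes "C \<in> F" "D \<in> F" "C \<noteq> D"
  shows "\<not> alternates (2 * pi) (\<lambda>\<theta>. supp C \<theta> - supp D \<theta>)"
proof (rule not_alternates_supp)
  show "finite (frontier C \<inter> frontier D)" "card (frontier C \<inter> frontier D) \<le> 2"
    using noncrossing assms by (auto simp: noncrossing_def)
  show "\<not> common_tangent_at_intersection C D"
    using general_position assms
    by (simp add: general_position_def common_tangent_at_intersection_def)
qed (use assms body in auto)

lemma generic_direction:
  obtains \<theta> where "inj_on (\<lambda>C. supp C \<theta>) F"
proof -
  define Z where "Z = (\<Union>C\<in>F. \<Union>D\<in>F - {C}. {\<theta> \<in> {0..<0 + 2 * pi}. supp C \<theta> - supp D \<theta> = 0})"
  have "finite Z"
    unfolding Z_def using finite not_alternates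
    by (intro finite_UN_I finite_Diff finite_zeros_if_not_alternates) auto
  moreover have "infinite {0..<0 + 2 * pi}" using pi_gt_zero by (intro infinite_Ico) simp
  ultimately obtain \<theta> where "\<theta> \<in> {0..<0 + 2 * pi} - Z"
    by (metis Diff_eq_empty_iff ex_in_conv finite_subset)
  then have "inj_on (\<lambda>C. supp C \<theta>) F"
    unfolding Z_def by (intro inj_onI) auto
  then show ?thesis by (rule that)
qed

lemma on_envelope_of_triple:
  assumes "C \<in> F" "D \<in> F" "E \<in> F" "C \<noteq> D" "C \<noteq> E" "D \<noteq> E" "K \<in> {C, D, E}"
  shows "on_upper_envelope supp {\<theta>..\<theta> + 2 * pi} {C, D, E} K"
proof -
  have "card {C, D, E} = 3" "{C, D, E} \<subseteq> F" using assms by auto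
  then have "convex_position {C, D, E}"
    using general_position by (simp add: general_position_def)
  then show ?thesis
    using assms compact nonempty
    by (subst (asm) convex_position_iff_on_upper_envelope[where \<theta> = \<theta>]) auto
qed

lemma no_common_supp_value:
  assumes "C \<in> F" "D \<in> F" "E \<in> F" "C \<noteq> D" "C \<noteq> E" "D \<noteq> E"
  shows "\<not> (supp C t = supp D t \<and> supp D t = supp E t)"
proof
  assume equal: "supp C t = supp D t \<and> supp D t = supp E t"
  have "card {C, D, E} = 3" "{C, D, E} \<subseteq> F" using assms by auto
  then have "\<not> (\<forall>K\<in>{C, D, E}. tangent_line {x. dir t \<bullet> x = supp C t} K)"
    using general_position unfolding general_position_def by metis
  moreover have "tangent_line {x. dir t \<bullet> x = supp C t} K" if "K \<in> {C, D, E}" for K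
    using tangent_line_support_fun[of K "dir t"] compact nonempty assms equal that by auto
  ultimately show False by blast
qed

lemma supp_overtakes_between:
  assumes "3 \<le> card F" "C \<in> F" "D \<in> F" and less: "supp D \<theta> < supp C \<theta>"
  shows "\<exists>a b. overtakes_between \<theta> (\<theta> + 2 * pi) a b (supp C) (supp D)"
proof -
  have "C \<noteq> D" using less by auto
  then have "card {C, D} < card F" using assms(1) by simp
  then obtain E where "E \<in> F" "E \<notin> {C, D}"
    by (metis card_mono finite.emptyI finite.insertI not_le subsetI)
  then have "on_upper_envelope supp {\<theta>..\<theta> + 2 * pi} {D, C, E} D"
    using assms(2,3) \<open>C \<noteq> D\<close> by (intro on_envelope_of_triple) auto
  then obtain t where "t \<in> {\<theta>..\<theta> + 2 * pi}" "supp C t < supp D t"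
    using \<open>C \<noteq> D\<close> unfolding on_upper_envelope_def by blast
  then show ?thesis
    using overtakes_between_if_not_alternates[of \<theta> "2 * pi" "supp C" "supp D" t]
      continuous_on_supp compact nonempty not_alternates[OF assms(3,2)] assms(2,3) less \<open>C \<noteq> D\<close>
    by (metis dir_add_2pi)
qed

lemma decreasing_supports_pseudoparabolas:
  fixes B :: "nat \<Rightarrow> plane set"
  assumes "3 \<le> card F" and B: "inj_on B X" "B ` X \<subseteq> F"
    and dec: "\<And>i j. \<lbrakk>i \<in> X; j \<in> X; i < j\<rbrakk> \<Longrightarrow> supp (B j) \<theta> < supp (B i) \<theta>"
  shows "\<exists>a b. pseudoparabolas X \<theta> (\<theta> + 2 * pi) (\<lambda>i. supp (B i)) a b"
proof -
  have "\<exists>a b. overtakes_between \<theta> (\<theta> + 2 * pi) a b (supp (B i)) (supp (B j))"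
    if "i \<in> X" "j \<in> X" "i < j" for i j
    using supp_overtakes_between[OF assms(1) _ _ dec] B that by blast
  then obtain a b where overtakes: "\<And>i j. \<lbrakk>i \<in> X; j \<in> X; i < j\<rbrakk> \<Longrightarrow>
      overtakes_between \<theta> (\<theta> + 2 * pi) (a i j) (b i j) (supp (B i)) (supp (B j))"
    by metis
  have "pseudoparabolas X \<theta> (\<theta> + 2 * pi) (\<lambda>i. supp (B i)) a b"
  proof
    fix i j k assume ijk: "i \<in> X" "j \<in> X" "k \<in> X" "i < j" "j < k"
    then have mem: "B i \<in> F" "B j \<in> F" "B k \<in> F" using B(2) by auto
    have neq: "B i \<noteq> B j" "B i \<noteq> B k" "B j \<noteq> B k"
      using ijk by (simp_all add: inj_on_eq_iff[OF B(1)])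
    show "\<not> (supp (B i) t = supp (B j) t \<and> supp (B j) t = supp (B k) t)" for t
      by (rule no_common_supp_value[OF mem neq])
    have "inj_on B {i, j, k}" using ijk by (intro inj_on_subset[OF B(1)]) simp
    then have "on_upper_envelope (\<lambda>i. supp (B i)) {\<theta>..\<theta> + 2 * pi} {i, j, k} l"
      if "l \<in> {i, j, k}" for l
      using on_envelope_of_triple[OF mem neq, of "B l"] that
      by (subst on_upper_envelope_reindex) auto
    then show "on_upper_envelope (\<lambda>i. supp (B i)) {\<theta>..\<theta> + 2 * pi} {i, j, k} j"
      "on_upper_envelope (\<lambda>i. supp (B i)) {\<theta>..\<theta> + 2 * pi} {i, j, k} k"
      by blast+
  qed (use overtakes in auto)
  then show ?thesis by blast
qed

lemma convex_position_subfamily: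
  assumes path: "monotone_path_property 3 n (card F)" and n: "3 \<le> n"
  shows "\<exists>G\<subseteq>F. card G = n \<and> convex_position G"
proof -
  have "3 \<le> card F" using monotone_path_property_imp_le[OF path] n by simp
  obtain \<theta> where "inj_on (\<lambda>C. supp C \<theta>) F" by (rule generic_direction)
  then obtain B where B: "bij_betw B {1..card F} F"
    and dec: "\<And>i j. \<lbrakk>i \<in> {1..card F}; j \<in> {1..card F}; i < j\<rbrakk> \<Longrightarrow> supp (B j) \<theta> < supp (B i) \<theta>"
    by (rule decreasing_enumeration[OF finite]) blast
  have "inj_on B {1..card F}" "B ` {1..card F} \<subseteq> F" using B by (auto simp: bij_betw_def)
  from decreasing_supports_pseudoparabolas[OF \<open>3 \<le> card F\<close> this dec] obtain a b where
    "pseudoparabolas {1..card F} \<theta> (\<theta> + 2 * pi) (\<lambda>i. supp (B i)) a b" by blast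
  then obtain Y where Y: "Y \<subseteq> {1..card F}" "card Y = n"
    and envelope: "\<And>k. k \<in> Y \<Longrightarrow> on_upper_envelope (\<lambda>i. supp (B i)) {\<theta>..\<theta> + 2 * pi} Y k"
    by (rule pseudoparabolas_subset_on_envelope[OF _ path n]) blast
  have inj: "inj_on B Y" using B Y(1) by (auto simp: bij_betw_def intro: inj_on_subset)
  have subfamily: "B ` Y \<subseteq> F" using B Y(1) by (auto simp: bij_betw_def)
  have "convex_position (B ` Y)"
    using subfamily compact nonempty finite_subset[OF subfamily finite] envelope
      on_upper_envelope_reindex[OF inj, of _ supp]
    by (subst convex_position_iff_on_upper_envelope[where \<theta> = \<theta>]) auto
  moreover have "card (B ` Y) = n" using inj Y(2) by (simp add: card_image)
  ultimately show ?thesis using subfamily by blast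
qed

end

lemma bodies_property_if_monotone_path_property:
  assumes "monotone_path_property 3 n N" "3 \<le> n"
  shows "bodies_property n N"
  unfolding bodies_property_def
proof (intro allI impI, elim conjE)
  fix F :: "plane set set"
  assume "finite F" "card F = N" "\<forall>C\<in>F. convex_body C" "noncrossing F" "general_position F"
  then interpret body_family F by unfold_locales auto
  show "\<exists>G\<subseteq>F. card G = n \<and> convex_position G"
    using assms \<open>card F = N\<close> by (intro convex_position_subfamily) auto
qed

theorem theorem6:
  fixes n :: nat
  assumes "n \<ge> 3"
  shows "(\<exists>N. bodies_property n N) \<and> (\<exists>N. monotone_path_property 3 n N) \<and>
         M_bodies n \<le> N\<^sub>3 3 n \<and>
         real (N\<^sub>3 3 n) \<le> 2 powr ((real n)\<^sup>2 * log 2 (real n))"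
proof (intro conjI)
  note path = monotone_path_property_3[OF assms]
  then show exists_path: "\<exists>N. monotone_path_property 3 n N" by blast
  have "bodies_property n (N\<^sub>3 3 n)"
    unfolding N\<^sub>3_def using LeastI_ex[OF exists_path] assms
    by (rule bodies_property_if_monotone_path_property)
  then show "\<exists>N. bodies_property n N" "M_bodies n \<le> N\<^sub>3 3 n"
    unfolding M_bodies_def by (auto intro: Least_le)
  have "N\<^sub>3 3 n \<le> n ^ n\<^sup>2" unfolding N\<^sub>3_def using path by (rule Least_le)
  then have "real (N\<^sub>3 3 n) \<le> real n ^ n\<^sup>2" by (metis of_nat_le_iff of_nat_power)
  also have "\<dots> = (2 powr log 2 (real n)) ^ n\<^sup>2" using assms by simp
  also have "\<dots> = 2 powr ((real n)\<^sup>2 * log 2 (real n))"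
    by (simp add: powr_power mult.commute)
  finally show "real (N\<^sub>3 3 n) \<le> 2 powr ((real n)\<^sup>2 * log 2 (real n))" .
qed

end
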